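(* Let $\mathcal{C}$ be the affine curve $v^2=16y^4+136y^2+1$ over $\mathbb{Q}$, with projective closure $\overline{\mathcal{C}}$, and let $E/\mathbb{Q}$ be the elliptic curve $Y^2=X(X-8)(X-9)$ with point at infinity $O$. Define a rational map $\phi:\mathcal{C}\dashrightarrow E$ on the affine chart by $\phi(y,v)=(X,Y)$, where $$X=\frac{v+4y^2+17}{2},\qquad Y=y\,(v+4y^2+17).$$ Then $(X,Y)$ satisfies $Y^2=X(X-8)(X-9)$. Moreover, $\phi$ extends to an isomorphism of smooth projective curves $\overline{\mathcal{C}}\to E$ over $\mathbb{Q}$ sending $$P_\infty^+=(1:4:0)\longmapsto O,\qquad P_\infty^-=(1:-4:0)\longmapsto (0,0).$$ The inverse map on affine points of $E$ with $X\neq 0$ is given by $$y=\frac{Y}{2X},\qquad v=X-\frac{72}{X}.$$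
   Context: $\overline{\mathcal{C}}$ denotes the projective closure of $\mathcal{C}$ in the weighted projective space $\mathbb{P}(1,2,1)$ with coordinates $(y:v:z)$ of weights $1,2,1$, i.e. the curve $v^2=16y^4+136y^2z^2+z^4$. The affine chart is $z=1$. The two points at infinity ($z=0$) are $P_\infty^{\pm}=(1:\pm4:0)$. *)

theory Defs
  imports "HOL-Analysis.Analysis" "HOL-Library.Poly_Mapping"
begin

text \<open>
  Varieties are treated classically. The field \<open>'k\<close> is an algebraically closed extension of the
  field of definition \<open>K\<close>, a variety is its set of \<open>'k\<close>-points, and "over \<open>K\<close>" means that all
  polynomials involved have coefficients in \<open>K\<close>. The variables are indexed by a finite type \<open>'n\<close>.
\<close>

type_synonym ('k, 'n) mpol = "('n \<Rightarrow>\<^sub>0 nat) \<Rightarrow>\<^sub>0 'k"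

definition var :: "'n \<Rightarrow> ('k::comm_ring_1, 'n) mpol" where
  "var i = Poly_Mapping.single (Poly_Mapping.single i 1) 1"

definition peval :: "('k::comm_ring_1, 'n::finite) mpol \<Rightarrow> 'k ^ 'n \<Rightarrow> 'k" where
  "peval p x = (\<Sum>m\<in>Poly_Mapping.keys p.
     Poly_Mapping.lookup p m * (\<Prod>i\<in>UNIV. (x $ i) ^ Poly_Mapping.lookup m i))"

definition partial_deriv :: "'n \<Rightarrow> ('k::comm_ring_1, 'n) mpol \<Rightarrow> ('k, 'n) mpol" where
  "partial_deriv i p = (\<Sum>m\<in>Poly_Mapping.keys p.
     Poly_Mapping.single (m - Poly_Mapping.single i 1)
       (of_nat (Poly_Mapping.lookup m i) * Poly_Mapping.lookup p m))"

definition defined_over :: "'k::comm_ring_1 set \<Rightarrow> ('k, 'n) mpol \<Rightarrow> bool" where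
  "defined_over K p \<longleftrightarrow> range (Poly_Mapping.lookup p) \<subseteq> K"

definition whomogeneous :: "nat ^ 'n \<Rightarrow> nat \<Rightarrow> ('k::comm_ring_1, 'n::finite) mpol \<Rightarrow> bool" where
  "whomogeneous w d p \<longleftrightarrow>
     (\<forall>m\<in>Poly_Mapping.keys p. (\<Sum>i\<in>UNIV. w $ i * Poly_Mapping.lookup m i) = d)"

definition wpoint :: "nat ^ 'n \<Rightarrow> 'k::field ^ 'n \<Rightarrow> ('k ^ 'n) set" where
  "wpoint w x = {y. \<exists>c. c \<noteq> 0 \<and> (\<forall>i. y $ i = c ^ (w $ i) * x $ i)}"

definition wproj :: "nat ^ 'n \<Rightarrow> ('k::field ^ 'n) set set" where
  "wproj w = {wpoint w x | x. x \<noteq> 0}"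

definition zero_locus :: "nat ^ 'n \<Rightarrow> ('k::field, 'n::finite) mpol set \<Rightarrow> ('k ^ 'n) set set" where
  "zero_locus w S = {P \<in> wproj w. \<forall>F\<in>S. \<forall>x\<in>P. peval F x = 0}"

definition zclosed :: "'k::field set \<Rightarrow> nat ^ 'n \<Rightarrow> ('k ^ 'n::finite) set set \<Rightarrow> bool" where
  "zclosed K w Z \<longleftrightarrow>
     (\<exists>S. (\<forall>F\<in>S. defined_over K F \<and> (\<exists>d. whomogeneous w d F)) \<and> Z = zero_locus w S)"

definition zopen_in ::
  "'k::field set \<Rightarrow> nat ^ 'n \<Rightarrow> ('k ^ 'n::finite) set set \<Rightarrow> ('k ^ 'n) set set \<Rightarrow> bool" where
  "zopen_in K w V U \<longleftrightarrow> (\<exists>Z. zclosed K w Z \<and> U = V - Z)"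

definition zclosure :: "nat ^ 'n \<Rightarrow> ('k::field ^ 'n::finite) set set \<Rightarrow> ('k ^ 'n) set set" where
  "zclosure w S = \<Inter>{Z. zclosed UNIV w Z \<and> S \<subseteq> Z}"

definition zirreducible :: "nat ^ 'n \<Rightarrow> ('k::field ^ 'n::finite) set set \<Rightarrow> bool" where
  "zirreducible w V \<longleftrightarrow> V \<noteq> {} \<and>
     (\<forall>Z1 Z2. zclosed UNIV w Z1 \<and> zclosed UNIV w Z2 \<and> V \<subseteq> Z1 \<union> Z2 \<longrightarrow> V \<subseteq> Z1 \<or> V \<subseteq> Z2)"

text \<open>
  The neighbourhood of \<open>P\<close> on which \<open>g = A / B\<close> is the whole nonvanishing locus of \<open>B\<close> in \<open>U\<close>. This
  is no restriction: a smaller basic neighbourhood given by \<open>H \<noteq> 0\<close> is obtained by writing \<open>g\<close> as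
  \<open>(A * H) / (B * H)\<close>.
\<close>

definition regular_on ::
  "'k::field set \<Rightarrow> nat ^ 'n \<Rightarrow> ('k ^ 'n::finite) set set \<Rightarrow> (('k ^ 'n) set \<Rightarrow> 'k) \<Rightarrow> bool" where
  "regular_on K w U g \<longleftrightarrow>
     (\<forall>P\<in>U. \<exists>d A B. defined_over K A \<and> defined_over K B \<and> whomogeneous w d A \<and> whomogeneous w d B \<and>
        (\<forall>x\<in>P. peval B x \<noteq> 0) \<and>
        (\<forall>Q\<in>U. \<forall>x\<in>Q. peval B x \<noteq> 0 \<longrightarrow> g Q = peval A x / peval B x))"

definition morphism_over ::
  "'k::field set \<Rightarrow> nat ^ 'n \<Rightarrow> ('k ^ 'n::finite) set set \<Rightarrow> nat ^ 'm \<Rightarrow> ('k ^ 'm::finite) set set \<Rightarrow>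
   (('k ^ 'n) set \<Rightarrow> ('k ^ 'm) set) \<Rightarrow> bool" where
  "morphism_over K w V w' V' f \<longleftrightarrow>
     f ` V \<subseteq> V' \<and>
     (\<forall>U. zopen_in K w' V' U \<longrightarrow> zopen_in K w V (V \<inter> f -` U)) \<and>
     (\<forall>U g. zopen_in K w' V' U \<and> regular_on K w' U g \<longrightarrow> regular_on K w (V \<inter> f -` U) (g \<circ> f))"

definition isomorphism_over ::
  "'k::field set \<Rightarrow> nat ^ 'n \<Rightarrow> ('k ^ 'n::finite) set set \<Rightarrow> nat ^ 'm \<Rightarrow> ('k ^ 'm::finite) set set \<Rightarrow>
   (('k ^ 'n) set \<Rightarrow> ('k ^ 'm) set) \<Rightarrow> (('k ^ 'm) set \<Rightarrow> ('k ^ 'n) set) \<Rightarrow> bool" where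
  "isomorphism_over K w V w' V' f g \<longleftrightarrow>
     morphism_over K w V w' V' f \<and> morphism_over K w' V' w V g \<and>
     (\<forall>P\<in>V. g (f P) = P) \<and> (\<forall>Q\<in>V'. f (g Q) = Q)"

text \<open>
  Smoothness is the Jacobian criterion on the charts \<open>x\<^sub>j = 1\<close> for the coordinates of weight 1, which
  are affine spaces: putting \<open>x\<^sub>j = 1\<close> commutes with the other partial derivatives. The curve is
  required to be covered by these charts, that is, to avoid the points where they do not apply. As
  \<open>'k\<close> is algebraically closed, \<open>zirreducible\<close> is geometric irreducibility.
\<close>

definition smooth_at :: "nat ^ 'n \<Rightarrow> ('k::field, 'n::finite) mpol \<Rightarrow> ('k ^ 'n) set \<Rightarrow> bool" where
  "smooth_at w F P \<longleftrightarrow>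
     (\<exists>x\<in>P. \<exists>j. w $ j = 1 \<and> x $ j = 1 \<and> (\<exists>i. i \<noteq> j \<and> peval (partial_deriv i F) x \<noteq> 0))"

definition smooth_projective_curve ::
  "'k::field set \<Rightarrow> nat ^ 3 \<Rightarrow> ('k, 3) mpol \<Rightarrow> bool" where
  "smooth_projective_curve K w F \<longleftrightarrow>
     defined_over K F \<and> (\<exists>d. whomogeneous w d F) \<and>
     zirreducible w (zero_locus w {F}) \<and> (\<forall>P\<in>zero_locus w {F}. smooth_at w F P)"

definition C_aff :: "('k::field \<times> 'k) set" where
  "C_aff = {(y, v). v^2 = 16 * y^4 + 136 * y^2 + 1}"

definition E_aff :: "('k::field \<times> 'k) set" where
  "E_aff = {(X, Y). Y^2 = X * (X - 8) * (X - 9)}"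

definition wC :: "nat ^ 3" where "wC = vector [1, 2, 1]"

definition wE :: "nat ^ 3" where "wE = vector [1, 1, 1]"

definition C_poly :: "('k::field, 3) mpol" where
  "C_poly = (var 2)^2 - (16 * (var 1)^4 + 136 * (var 1)^2 * (var 3)^2 + (var 3)^4)"

definition E_poly :: "('k::field, 3) mpol" where
  "E_poly = (var 2)^2 * var 3 - var 1 * (var 1 - 8 * var 3) * (var 1 - 9 * var 3)"

definition C_bar :: "('k::field ^ 3) set set" where
  "C_bar = zero_locus wC {C_poly}"

definition E_curve :: "('k::field ^ 3) set set" where
  "E_curve = zero_locus wE {E_poly}"

definition C_pt :: "'k::field \<Rightarrow> 'k \<Rightarrow> 'k \<Rightarrow> ('k ^ 3) set" where
  "C_pt y v z = wpoint wC (vector [y, v, z])"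

definition E_pt :: "'k::field \<Rightarrow> 'k \<Rightarrow> 'k \<Rightarrow> ('k ^ 3) set" where
  "E_pt X Y Z = wpoint wE (vector [X, Y, Z])"

definition phi :: "'k::field \<times> 'k \<Rightarrow> 'k \<times> 'k" where
  "phi = (\<lambda>(y, v). ((v + 4 * y^2 + 17) / 2, y * (v + 4 * y^2 + 17)))"

end

theory Submission
  imports Defs
begin

text \<open>
  On the affine curve, \<open>X = (v + 4 y\<^sup>2 + 17) / 2\<close> satisfies \<open>X (X - v) = 72\<close>: this is the
  equation of the curve written as \<open>(4 y\<^sup>2 + 17 + v) (4 y\<^sup>2 + 17 - v) = 288\<close>. Hence \<open>X \<noteq> 0\<close> and
  \<open>v = X - 72 / X\<close>, while \<open>Y = 2 X y\<close> recovers \<open>y\<close>; together with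
  \<open>4 y\<^sup>2 = 2 X - v - 17\<close> this gives \<open>Y\<^sup>2 = X (X - 8) (X - 9)\<close>, and every step can be reversed. So
  \<open>\<phi>\<close> is a bijection between the affine curve and the affine points of \<open>E\<close> with \<open>X \<noteq> 0\<close>
  (\<open>phi_on_C_aff\<close>, \<open>phi_inverse_on_E_aff\<close>).

  The map and its inverse extend to the remaining two points on each side because each of them has
  two presentations by tuples of forms, the second obtained from the first with the equation of the
  curve, which agree where both make sense and together make sense everywhere (\<open>phi_atlas\<close>,
  \<open>psi_atlas\<close>). A map with such presentations is a morphism (\<open>morphism_over_glue\<close>): zero loci and
  quotients of forms are pulled back by substitution. That the two maps are inverse to each other is
  then checked on the affine points and on the two special ones.

  For irreducibility, a form restricted to a chart \<open>v\<^sup>2 = f(t)\<close> becomes \<open>a(t) + b(t) v\<close>. Its norm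
  \<open>a\<^sup>2 - f b\<^sup>2\<close> is multiplicative and vanishes only for \<open>a = b = 0\<close>, since \<open>f\<close> has a simple
  root. So on a chart a product of two forms vanishes only if one factor does
  (\<open>linear_in_v_zero_product\<close>). Applied on the chart \<open>z = 1\<close> this gives irreducibility. Applied on
  the chart \<open>y = 1\<close>, with \<open>z\<close> as the second factor, it shows that a form vanishing on the affine
  curve vanishes at infinity, so that the closure of the affine curve contains the points at
  infinity (\<open>vanishes_on_C_bar_if_on_C_aff\<close>). Irreducibility passes to \<open>E\<close> along the surjective
  morphism \<open>\<phi>\<close>.
\<close>

section \<open>Polynomials and their values\<close>

lemma mpol_eq_sum_monomials:
  fixes p :: "('k::comm_ring_1, 'n) mpol"
  shows "(\<Sum>m\<in>Poly_Mapping.keys p. Poly_Mapping.single m (Poly_Mapping.lookup p m)) = p"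
proof (rule poly_mapping_eqI)
  fix k
  have "Poly_Mapping.lookup (\<Sum>m\<in>Poly_Mapping.keys p.
          Poly_Mapping.single m (Poly_Mapping.lookup p m)) k =
        (\<Sum>m\<in>Poly_Mapping.keys p. if m = k then Poly_Mapping.lookup p m else 0)"
    by (simp add: lookup_sum lookup_single when_def)
  also have "\<dots> = Poly_Mapping.lookup p k"
    by (simp add: in_keys_iff)
  finally show "Poly_Mapping.lookup (\<Sum>m\<in>Poly_Mapping.keys p.
          Poly_Mapping.single m (Poly_Mapping.lookup p m)) k = Poly_Mapping.lookup p k" .
qed

lemma mpol_induct [case_names single add]:
  fixes p :: "('k::comm_ring_1, 'n) mpol"
  assumes single: "\<And>m c. P (Poly_Mapping.single m c)"
    and add: "\<And>p q. P p \<Longrightarrow> P q \<Longrightarrow> P (p + q)"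
  shows "P p"
proof -
  have "P (\<Sum>m\<in>A. Poly_Mapping.single m (Poly_Mapping.lookup p m))" if "finite A" for A
    using that
  proof induction
    case empty
    show ?case using single[of 0 0] by simp
  next
    case (insert m A)
    then show ?case by (simp add: single add)
  qed
  from this[OF finite_keys[of p]] show ?thesis by (simp add: mpol_eq_sum_monomials)
qed

lemma peval_superset:
  assumes "finite A" "Poly_Mapping.keys p \<subseteq> A"
  shows "peval p x = (\<Sum>m\<in>A. Poly_Mapping.lookup p m * (\<Prod>i\<in>UNIV. (x $ i) ^ Poly_Mapping.lookup m i))"
  unfolding peval_def using assms by (intro sum.mono_neutral_left) (auto simp: in_keys_iff)

lemma peval_add [simp]: "peval (p + q) x = peval p x + peval q x"
proof -
  let ?A = "Poly_Mapping.keys p \<union> Poly_Mapping.keys q"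
  have "Poly_Mapping.keys (p + q) \<subseteq> ?A" by (rule keys_add)
  then show ?thesis
    by (simp add: peval_superset[of ?A] lookup_add algebra_simps sum.distrib)
qed

lemma peval_single:
  "peval (Poly_Mapping.single m c) x = c * (\<Prod>i\<in>UNIV. (x $ i) ^ Poly_Mapping.lookup m i)"
  by (simp add: peval_superset[of "{m}"])

lemma peval_const [simp]: "peval (Poly_Mapping.single 0 c) x = c"
  by (simp add: peval_single)

lemma peval_zero [simp]: "peval 0 x = 0"
  by (simp add: peval_def)

lemma peval_one [simp]: "peval 1 x = 1"
  using peval_const[of 1 x] by (simp only: single_one)

lemma peval_numeral [simp]: "peval (numeral n) x = numeral n"
  using peval_const[of "numeral n" x] by (simp only: single_numeral)

lemma peval_uminus [simp]: "peval (- p) x = - peval p x"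
  using peval_add[of "- p" p x] by (simp add: eq_neg_iff_add_eq_0)

lemma peval_diff [simp]: "peval (p - q) x = peval p x - peval q x"
  using peval_add[of p "- q" x] by simp

lemma peval_mult [simp]: "peval (p * q) x = peval p x * peval q x"
proof (induction p rule: mpol_induct)
  case (single m c)
  show ?case
    by (induction q rule: mpol_induct)
       (simp_all add: mult_single peval_single lookup_add power_add prod.distrib algebra_simps)
qed (simp add: algebra_simps)

lemma peval_power [simp]: "peval (p ^ n) x = peval p x ^ n"
  by (induction n) simp_all

lemma peval_sum [simp]: "peval (sum f A) x = (\<Sum>a\<in>A. peval (f a) x)"
  by (induction A rule: infinite_finite_induct) simp_all

lemma peval_prod [simp]: "peval (prod f A) x = (\<Prod>a\<in>A. peval (f a) x)"
  by (induction A rule: infinite_finite_induct) simp_all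

lemma peval_var [simp]: "peval (var i) x = x $ i"
proof -
  have "(\<Prod>j\<in>UNIV. (x $ j) ^ Poly_Mapping.lookup (Poly_Mapping.single i 1) j) =
      (\<Prod>j\<in>UNIV. if j = i then x $ i else 1)"
    by (intro prod.cong) (auto simp: lookup_single when_def)
  then show ?thesis by (simp add: var_def peval_single)
qed

lemma peval_origin: "peval p 0 = Poly_Mapping.lookup p 0"
proof -
  have "(\<Prod>i\<in>UNIV. ((0 :: 'a ^ 'b) $ i) ^ Poly_Mapping.lookup m i) = (if m = 0 then 1 else 0)"
    for m :: "'b \<Rightarrow>\<^sub>0 nat"
  proof (cases "m = 0")
    case False
    then obtain i where "Poly_Mapping.lookup m i \<noteq> 0"
      by (metis lookup_zero poly_mapping_eqI)
    then have "\<exists>i\<in>UNIV. ((0 :: 'a ^ 'b) $ i) ^ Poly_Mapping.lookup m i = 0"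
      by (intro bexI[of _ i]) (simp_all add: zero_power)
    then show ?thesis using False by (metis prod_zero finite)
  qed simp
  then have "peval p 0 = (\<Sum>m\<in>Poly_Mapping.keys p. if m = 0 then Poly_Mapping.lookup p m else 0)"
    unfolding peval_def by (intro sum.cong) auto
  then show ?thesis by (simp add: in_keys_iff)
qed

subsection \<open>Partial derivatives\<close>

lemma partial_deriv_superset:
  assumes "finite A" "Poly_Mapping.keys p \<subseteq> A"
  shows "partial_deriv i p = (\<Sum>m\<in>A. Poly_Mapping.single (m - Poly_Mapping.single i 1)
       (of_nat (Poly_Mapping.lookup m i) * Poly_Mapping.lookup p m))"
  unfolding partial_deriv_def using assms
  by (intro sum.mono_neutral_left) (auto simp: in_keys_iff)

lemma partial_deriv_add [simp]:
  "partial_deriv i (p + q) = partial_deriv i p + partial_deriv i q"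
proof -
  let ?A = "Poly_Mapping.keys p \<union> Poly_Mapping.keys q"
  have "Poly_Mapping.keys (p + q) \<subseteq> ?A" by (rule keys_add)
  then show ?thesis
    by (simp add: partial_deriv_superset[of ?A] lookup_add algebra_simps sum.distrib single_add)
qed

lemma partial_deriv_single:
  "partial_deriv i (Poly_Mapping.single m c) =
     Poly_Mapping.single (m - Poly_Mapping.single i 1) (of_nat (Poly_Mapping.lookup m i) * c)"
  by (simp add: partial_deriv_superset[of "{m}"])

lemma partial_deriv_const [simp]: "partial_deriv i (Poly_Mapping.single 0 c) = 0"
  by (simp add: partial_deriv_single)

lemma partial_deriv_one [simp]: "partial_deriv i 1 = 0"
  using partial_deriv_const[of i 1] by (simp only: single_one)

lemma partial_deriv_numeral [simp]: "partial_deriv i (numeral n) = 0"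
  using partial_deriv_const[of i "numeral n"] by (simp only: single_numeral)

lemma partial_deriv_uminus [simp]: "partial_deriv i (- p) = - partial_deriv i p"
proof -
  have "partial_deriv i (- p) + partial_deriv i p = partial_deriv i (- p + p)"
    by (simp only: partial_deriv_add)
  also have "\<dots> = 0"
    by (simp add: partial_deriv_def del: partial_deriv_add)
  finally show ?thesis by (simp only: eq_neg_iff_add_eq_0)
qed

lemma partial_deriv_diff [simp]: "partial_deriv i (p - q) = partial_deriv i p - partial_deriv i q"
  using partial_deriv_add[of i p "- q"] by simp

lemma partial_deriv_monomial_mult:
  "partial_deriv i (Poly_Mapping.single m a * Poly_Mapping.single n b) =
     partial_deriv i (Poly_Mapping.single m a) * Poly_Mapping.single n b +
     Poly_Mapping.single m a * partial_deriv i (Poly_Mapping.single n b)"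
proof -
  let ?e = "Poly_Mapping.single i (1::nat)"
  (* Truncated subtraction of exponents is harmless where the exponent does not vanish. *)
  have shift: "(m - ?e) + n = m + n - ?e" if "Poly_Mapping.lookup m i \<noteq> 0" for m n
    using that by (intro poly_mapping_eqI)
      (auto simp: lookup_add lookup_minus lookup_single when_def)
  have 1: "Poly_Mapping.single ((m - ?e) + n) (of_nat (Poly_Mapping.lookup m i) * a * b) =
      Poly_Mapping.single (m + n - ?e) (of_nat (Poly_Mapping.lookup m i) * a * b)"
    by (cases "Poly_Mapping.lookup m i = 0") (simp_all add: shift del: One_nat_def)
  have 2: "Poly_Mapping.single (m + (n - ?e)) (a * (of_nat (Poly_Mapping.lookup n i) * b)) =
      Poly_Mapping.single (m + n - ?e) (a * (of_nat (Poly_Mapping.lookup n i) * b))"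
    by (cases "Poly_Mapping.lookup n i = 0")
       (simp_all add: shift[of n m] add.commute[of m] del: One_nat_def)
  show ?thesis
    unfolding mult_single partial_deriv_single 1 2
    by (simp add: lookup_add single_add[symmetric] algebra_simps)
qed

lemma partial_deriv_mult [simp]:
  "partial_deriv i (p * q) = partial_deriv i p * q + p * partial_deriv i q"
proof (induction p rule: mpol_induct)
  case (single m c)
  show ?case
    by (induction q rule: mpol_induct)
       (simp_all add: partial_deriv_monomial_mult algebra_simps)
qed (simp add: algebra_simps)

lemma partial_deriv_power [simp]:
  "partial_deriv i (p ^ n) = of_nat n * p ^ (n - 1) * partial_deriv i p"
proof (induction n)
  case (Suc n)
  then show ?case by (cases n) (simp_all add: algebra_simps)
qed simp

lemma partial_deriv_var [simp]: "partial_deriv i (var j) = (if i = j then 1 else 0)"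
  by (simp add: var_def partial_deriv_single lookup_single when_def)

subsection \<open>Fields of definition and weighted degrees\<close>

text \<open>
  Morphisms are wanted over \<open>\<rat>\<close> for the isomorphism and over the whole field for the transfer of
  irreducibility; in both cases the coefficients form a ring.
\<close>

definition subring_set :: "'k::comm_ring_1 set \<Rightarrow> bool" where
  "subring_set K \<longleftrightarrow> 0 \<in> K \<and> 1 \<in> K \<and> (\<forall>a\<in>K. \<forall>b\<in>K. a + b \<in> K \<and> a - b \<in> K \<and> a * b \<in> K)"

lemma subring_set_Rats: "subring_set (\<rat> :: 'k::field_char_0 set)"
  by (simp add: subring_set_def)

lemma subring_set_UNIV: "subring_set UNIV"
  by (simp add: subring_set_def)

lemma subring_set_sum:
  "subring_set K \<Longrightarrow> (\<And>a. a \<in> A \<Longrightarrow> f a \<in> K) \<Longrightarrow> sum f A \<in> K"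
  by (induction A rule: infinite_finite_induct) (auto simp: subring_set_def)

lemma subring_set_numeral: "subring_set K \<Longrightarrow> numeral n \<in> K"
  by (induction n rule: num.induct)
     (simp_all only: numeral.simps subring_set_def, blast+)

lemma defined_over_iff: "defined_over K p \<longleftrightarrow> (\<forall>m. Poly_Mapping.lookup p m \<in> K)"
  by (auto simp: defined_over_def)

lemma defined_over_single:
  "subring_set K \<Longrightarrow> c \<in> K \<Longrightarrow> defined_over K (Poly_Mapping.single m c)"
  by (simp add: defined_over_iff lookup_single when_def subring_set_def)

lemma defined_over_sum:
  "subring_set K \<Longrightarrow> (\<And>a. a \<in> A \<Longrightarrow> defined_over K (f a)) \<Longrightarrow> defined_over K (sum f A)"
  by (auto simp: defined_over_iff lookup_sum intro: subring_set_sum)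

lemma defined_over_add:
  "subring_set K \<Longrightarrow> defined_over K p \<Longrightarrow> defined_over K q \<Longrightarrow> defined_over K (p + q)"
  by (auto simp: defined_over_iff lookup_add subring_set_def)

lemma defined_over_diff:
  "subring_set K \<Longrightarrow> defined_over K p \<Longrightarrow> defined_over K q \<Longrightarrow> defined_over K (p - q)"
  by (auto simp: defined_over_iff lookup_minus subring_set_def)

lemma mpol_mult_eq_sum:
  fixes p q :: "('k::comm_ring_1, 'n) mpol"
  shows "p * q = (\<Sum>m\<in>Poly_Mapping.keys p. \<Sum>n\<in>Poly_Mapping.keys q.
     Poly_Mapping.single (m + n) (Poly_Mapping.lookup p m * Poly_Mapping.lookup q n))"
  by (subst (1 2) mpol_eq_sum_monomials[symmetric]) (simp only: sum_product mult_single)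

lemma defined_over_mult:
  assumes "subring_set K" "defined_over K p" "defined_over K q"
  shows "defined_over K (p * q)"
  using assms unfolding mpol_mult_eq_sum[of p q]
  by (intro defined_over_sum defined_over_single) (auto simp: defined_over_iff subring_set_def)

lemma defined_over_one: "subring_set K \<Longrightarrow> defined_over K 1"
  using defined_over_single[of K 1 0] by (simp add: subring_set_def)

lemma defined_over_numeral: "subring_set K \<Longrightarrow> defined_over K (numeral n)"
  using defined_over_single[of K "numeral n" 0] by (simp add: subring_set_numeral)

lemma defined_over_var: "subring_set K \<Longrightarrow> defined_over K (var i)"
  unfolding var_def by (rule defined_over_single) (auto simp: subring_set_def)

lemma defined_over_prod:
  "subring_set K \<Longrightarrow> (\<And>a. a \<in> A \<Longrightarrow> defined_over K (f a)) \<Longrightarrow> defined_over K (prod f A)"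
  by (induction A rule: infinite_finite_induct)
     (auto intro: defined_over_mult defined_over_one)

lemma defined_over_power:
  "subring_set K \<Longrightarrow> defined_over K p \<Longrightarrow> defined_over K (p ^ n)"
  by (induction n) (auto intro: defined_over_mult defined_over_one)

lemmas defined_over_intros =
  defined_over_add defined_over_diff defined_over_mult defined_over_power
  defined_over_numeral defined_over_var

lemma whomogeneous_add:
  "whomogeneous w d p \<Longrightarrow> whomogeneous w d q \<Longrightarrow> whomogeneous w d (p + q)"
  using keys_add[of p q] by (fastforce simp: whomogeneous_def)

lemma whomogeneous_diff:
  fixes p q :: "('k::comm_ring_1, 'n::finite) mpol"
  shows "whomogeneous w d p \<Longrightarrow> whomogeneous w d q \<Longrightarrow> whomogeneous w d (p - q)"
  unfolding whomogeneous_def by (metis in_keys_iff lookup_minus diff_0_right)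

lemma whomogeneous_sum:
  "(\<And>a. a \<in> A \<Longrightarrow> whomogeneous w d (f a)) \<Longrightarrow> whomogeneous w d (sum f A)"
  by (induction A rule: infinite_finite_induct)
     (auto intro: whomogeneous_add simp: whomogeneous_def[of _ _ 0])

lemma whomogeneous_mult:
  assumes "whomogeneous w d p" "whomogeneous w e q"
  shows "whomogeneous w (d + e) (p * q)"
  unfolding whomogeneous_def
proof
  fix m assume "m \<in> Poly_Mapping.keys (p * q)"
  then obtain a b where "m = a + b" "a \<in> Poly_Mapping.keys p" "b \<in> Poly_Mapping.keys q"
    using keys_mult[of p q] by blast
  with assms show "(\<Sum>i\<in>UNIV. w $ i * Poly_Mapping.lookup m i) = d + e"
    by (simp add: whomogeneous_def lookup_add algebra_simps sum.distrib)
qed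

lemma whomogeneous_const: "whomogeneous w 0 (Poly_Mapping.single 0 c)"
  by (simp add: whomogeneous_def)

lemma whomogeneous_one: "whomogeneous w 0 1"
  by (simp add: whomogeneous_def)

lemma whomogeneous_numeral: "whomogeneous w 0 (numeral n)"
  using whomogeneous_const[of w "numeral n"] by simp

lemma whomogeneous_var: "whomogeneous w (w $ i) (var i)"
proof -
  have "(\<Sum>j\<in>UNIV. w $ j * Poly_Mapping.lookup (Poly_Mapping.single i 1) j) =
      (\<Sum>j\<in>UNIV. if j = i then w $ i else 0)"
    by (intro sum.cong) (auto simp: lookup_single when_def)
  then show ?thesis by (simp add: whomogeneous_def var_def)
qed

lemma whomogeneous_power: "whomogeneous w d p \<Longrightarrow> whomogeneous w (n * d) (p ^ n)"
  by (induction n) (simp_all add: whomogeneous_one whomogeneous_mult)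

lemma whomogeneous_prod:
  "(\<And>a. a \<in> A \<Longrightarrow> whomogeneous w (d a) (f a)) \<Longrightarrow> whomogeneous w (sum d A) (prod f A)"
  by (induction A rule: infinite_finite_induct)
     (auto intro: whomogeneous_mult simp: whomogeneous_one)

text \<open>
  The action of the multiplicative group whose orbits are the points of weighted projective space.
\<close>

definition wscale :: "nat ^ 'n \<Rightarrow> 'k::field \<Rightarrow> 'k ^ 'n \<Rightarrow> 'k ^ 'n" where
  "wscale w c x = (\<chi> i. c ^ (w $ i) * x $ i)"

lemma peval_wscale:
  assumes "whomogeneous w d p"
  shows "peval p (wscale w c x) = c ^ d * peval p x"
  unfolding peval_def sum_distrib_left
proof (rule sum.cong[OF refl])
  fix m assume "m \<in> Poly_Mapping.keys p"
  then have d: "d = (\<Sum>i\<in>UNIV. w $ i * Poly_Mapping.lookup m i)"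
    using assms by (simp add: whomogeneous_def)
  show "Poly_Mapping.lookup p m * (\<Prod>i\<in>UNIV. (wscale w c x $ i) ^ Poly_Mapping.lookup m i) =
      c ^ d * (Poly_Mapping.lookup p m * (\<Prod>i\<in>UNIV. (x $ i) ^ Poly_Mapping.lookup m i))"
    by (simp add: d wscale_def power_mult_distrib prod.distrib power_sum power_mult)
qed

text \<open>
  The variables have positive weights, so only constants fail to vanish at the origin. The origin is
  not a point of the weighted projective space, but it is the value of a tuple of forms at their
  common zeros.
\<close>

lemma whomogeneous_origin:
  assumes "\<And>i. w $ i > 0" "whomogeneous w d p"
  shows "peval p 0 = 0 \<or> d = 0"
  using assms by (force simp: peval_origin whomogeneous_def in_keys_iff)

lemma whomogeneous_degree_0:
  fixes p :: "('k::comm_ring_1, 'n::finite) mpol"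
  assumes "\<And>i. w $ i > 0" "whomogeneous w 0 p"
  shows "peval p x = peval p y"
proof -
  have "m = 0" if "m \<in> Poly_Mapping.keys p" for m
  proof (rule poly_mapping_eqI)
    fix i
    have "(\<Sum>j\<in>UNIV. w $ j * Poly_Mapping.lookup m j) = 0"
      using that assms(2) by (simp add: whomogeneous_def)
    then show "Poly_Mapping.lookup m i = Poly_Mapping.lookup 0 i"
      using assms(1)[of i] by (auto dest: spec[of _ i])
  qed
  then have "Poly_Mapping.keys p \<subseteq> {0}" by blast
  then show ?thesis by (simp add: peval_superset[of "{0}"])
qed

subsection \<open>Substitution\<close>

definition psubst :: "('k::comm_ring_1, 'm::finite) mpol \<Rightarrow> ('k, 'n) mpol ^ 'm \<Rightarrow> ('k, 'n) mpol" where
  "psubst p G = (\<Sum>m\<in>Poly_Mapping.keys p.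
     Poly_Mapping.single 0 (Poly_Mapping.lookup p m) * (\<Prod>j\<in>UNIV. (G $ j) ^ Poly_Mapping.lookup m j))"

definition pmap :: "('k::comm_ring_1, 'n::finite) mpol ^ 'm \<Rightarrow> 'k ^ 'n \<Rightarrow> 'k ^ 'm" where
  "pmap G x = (\<chi> j. peval (G $ j) x)"

lemma peval_psubst [simp]: "peval (psubst p G) x = peval p (pmap G x)"
  by (simp add: psubst_def pmap_def peval_def[of p])

lemma defined_over_psubst:
  assumes "subring_set K" "defined_over K p" "\<And>j. defined_over K (G $ j)"
  shows "defined_over K (psubst p G)"
  unfolding psubst_def using assms
  by (intro defined_over_sum defined_over_mult defined_over_single defined_over_prod
        defined_over_power) (auto simp: defined_over_iff)

lemma whomogeneous_psubst:
  assumes "whomogeneous w' d p" "\<And>j. whomogeneous w (e * w' $ j) (G $ j)"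
  shows "whomogeneous w (e * d) (psubst p G)"
  unfolding psubst_def
proof (rule whomogeneous_sum)
  fix m assume "m \<in> Poly_Mapping.keys p"
  then have d: "d = (\<Sum>j\<in>UNIV. w' $ j * Poly_Mapping.lookup m j)"
    using assms by (simp add: whomogeneous_def)
  have "whomogeneous w (\<Sum>j\<in>UNIV. Poly_Mapping.lookup m j * (e * w' $ j))
      (\<Prod>j\<in>UNIV. (G $ j) ^ Poly_Mapping.lookup m j)"
    by (intro whomogeneous_prod whomogeneous_power assms)
  also have "(\<Sum>j\<in>UNIV. Poly_Mapping.lookup m j * (e * w' $ j)) = e * d"
    by (simp add: d sum_distrib_left algebra_simps)
  finally show "whomogeneous w (e * d) (Poly_Mapping.single 0 (Poly_Mapping.lookup p m) *
      (\<Prod>j\<in>UNIV. (G $ j) ^ Poly_Mapping.lookup m j))"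
    using whomogeneous_mult[OF whomogeneous_const] by fastforce
qed

section \<open>Morphisms glued from tuples of forms\<close>

lemma wscale_nth: "wscale w c x $ i = c ^ (w $ i) * x $ i"
  by (simp add: wscale_def)

lemma wscale_one [simp]: "wscale w 1 x = x"
  by (simp add: wscale_def)

lemma wscale_wscale: "wscale w c (wscale w d x) = wscale w (c * d) x"
  by (simp add: wscale_def power_mult_distrib algebra_simps)

lemma wpoint_eq_wscale: "wpoint w x = {wscale w c x | c. c \<noteq> 0}"
  by (auto simp: wpoint_def wscale_def vec_eq_iff)

lemma wpoint_self: "x \<in> wpoint w x"
  unfolding wpoint_eq_wscale by (rule CollectI, rule exI[of _ 1]) simp

lemma wpoint_wscale:
  assumes "c \<noteq> 0"
  shows "wpoint w (wscale w c x) = wpoint w x"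
proof (intro equalityI subsetI)
  fix y assume "y \<in> wpoint w (wscale w c x)"
  then show "y \<in> wpoint w x"
    using assms by (auto simp: wpoint_eq_wscale wscale_wscale)
next
  fix y assume "y \<in> wpoint w x"
  then obtain d where "y = wscale w d x" "d \<noteq> 0" by (auto simp: wpoint_eq_wscale)
  then have "y = wscale w (d / c) (wscale w c x)" "d / c \<noteq> 0"
    using assms by (simp_all add: wscale_wscale)
  then show "y \<in> wpoint w (wscale w c x)" by (auto simp: wpoint_eq_wscale)
qed

lemma wpoint_eqI: "c \<noteq> 0 \<Longrightarrow> y = wscale w c x \<Longrightarrow> wpoint w y = wpoint w x"
  by (simp add: wpoint_wscale)

lemma wpoint_eqD: "y \<in> wpoint w x \<Longrightarrow> wpoint w y = wpoint w x"
  by (subst (asm) wpoint_eq_wscale) (auto simp: wpoint_wscale)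

lemma wscale_eq_0_iff:
  assumes "c \<noteq> 0"
  shows "wscale w c x = 0 \<longleftrightarrow> x = 0"
  using assms by (simp add: vec_eq_iff wscale_nth)

lemma wproj_rep:
  assumes "P \<in> wproj w" "x \<in> P"
  shows "P = wpoint w x" "x \<noteq> 0"
proof -
  obtain z where z: "P = wpoint w z" "z \<noteq> 0" using assms(1) by (auto simp: wproj_def)
  with assms(2) show "P = wpoint w x" by (simp add: wpoint_eqD)
  from z assms(2) obtain c where "x = wscale w c z" "c \<noteq> 0" by (auto simp: wpoint_eq_wscale)
  with z(2) show "x \<noteq> 0" by (simp add: wscale_eq_0_iff)
qed

lemma wproj_obtain:
  assumes "P \<in> wproj w"
  obtains x where "P = wpoint w x" "x \<noteq> 0"
  using assms by (auto simp: wproj_def)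

lemma wproj_nonempty: "P \<in> wproj w \<Longrightarrow> P \<noteq> {}"
  unfolding wproj_def using wpoint_self by blast

lemma whomogeneous_vanishes_on_wpoint:
  assumes "whomogeneous w d F" "peval F x = 0" "y \<in> wpoint w x"
  shows "peval F y = 0"
proof -
  obtain c where "y = wscale w c x" using assms(3) by (auto simp: wpoint_eq_wscale)
  then show ?thesis using assms by (simp add: peval_wscale)
qed

lemma wpoint_in_zero_locus:
  assumes "\<And>F. F \<in> S \<Longrightarrow> \<exists>d. whomogeneous w d F" "x \<noteq> 0"
  shows "wpoint w x \<in> zero_locus w S \<longleftrightarrow> (\<forall>F\<in>S. peval F x = 0)"
proof -
  have "wpoint w x \<in> wproj w" using assms(2) by (auto simp: wproj_def)
  moreover have "(\<forall>y\<in>wpoint w x. peval F y = 0) \<longleftrightarrow> peval F x = 0" if F: "F \<in> S" for F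
  proof -
    obtain d where "whomogeneous w d F" using assms(1)[OF F] ..
    then show ?thesis
      using whomogeneous_vanishes_on_wpoint[of w d F x] wpoint_self[of x w] by blast
  qed
  ultimately show ?thesis by (simp add: zero_locus_def)
qed

lemma zero_locus_subset_wproj: "zero_locus w S \<subseteq> wproj w"
  by (auto simp: zero_locus_def)

text \<open>
  Several tuples of forms present one map of weighted projective spaces: each tuple determines it
  wherever its entries do not all vanish, and says nothing at their common zeros. The degrees within a
  tuple are proportional to the weights of the target, so that a change of representative
  of the point rescales the value.
\<close>

definition form_atlas ::
  "'k::field set \<Rightarrow> nat ^ 'n \<Rightarrow> ('k ^ 'n::finite) set set \<Rightarrow> nat ^ 'm \<Rightarrow> ('k ^ 'm::finite) set set \<Rightarrow>
   (('k, 'n) mpol ^ 'm) set \<Rightarrow> bool" where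
  "form_atlas K w V w' V' \<G> \<longleftrightarrow>
     (\<forall>G\<in>\<G>. \<exists>e. \<forall>j. defined_over K (G $ j) \<and> whomogeneous w (e * w' $ j) (G $ j)) \<and>
     (\<forall>x. x \<noteq> 0 \<and> wpoint w x \<in> V \<longrightarrow> (\<exists>G\<in>\<G>. pmap G x \<noteq> 0)) \<and>
     (\<forall>x. x \<noteq> 0 \<and> wpoint w x \<in> V \<longrightarrow>
       (\<forall>G\<in>\<G>. pmap G x \<noteq> 0 \<longrightarrow> wpoint w' (pmap G x) \<in> V' \<and>
         (\<forall>H\<in>\<G>. pmap H x \<noteq> 0 \<longrightarrow> wpoint w' (pmap G x) = wpoint w' (pmap H x))))"

lemma form_atlas_forms:
  assumes "form_atlas K w V w' V' \<G>" "G \<in> \<G>"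
  shows "\<exists>e. \<forall>j. defined_over K (G $ j) \<and> whomogeneous w (e * w' $ j) (G $ j)"
  by (rule assms(1)[unfolded form_atlas_def, THEN conjunct1, rule_format, OF assms(2)])

lemma form_atlas_cover:
  assumes "form_atlas K w V w' V' \<G>" "x \<noteq> 0" "wpoint w x \<in> V"
  shows "\<exists>G\<in>\<G>. pmap G x \<noteq> 0"
  by (rule assms(1)[unfolded form_atlas_def, THEN conjunct2, THEN conjunct1, rule_format,
        OF conjI, OF assms(2,3)])

lemma form_atlas_value:
  assumes "form_atlas K w V w' V' \<G>" "x \<noteq> 0" "wpoint w x \<in> V" "G \<in> \<G>" "pmap G x \<noteq> 0"
  shows form_atlas_target: "wpoint w' (pmap G x) \<in> V'"
    and form_atlas_compat:
      "H \<in> \<G> \<Longrightarrow> pmap H x \<noteq> 0 \<Longrightarrow> wpoint w' (pmap G x) = wpoint w' (pmap H x)"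
proof -
  note * = assms(1)[unfolded form_atlas_def, THEN conjunct2, THEN conjunct2, rule_format,
      OF conjI, OF assms(2-5)]
  show "wpoint w' (pmap G x) \<in> V'"
    by (rule *[THEN conjunct1])
  show "wpoint w' (pmap G x) = wpoint w' (pmap H x)" if "H \<in> \<G>" "pmap H x \<noteq> 0"
    by (rule *[THEN conjunct2, rule_format, OF that])
qed

text \<open>
  The choice does not matter on the domain of an atlas: representatives of one point have equal
  values up to scaling, and so do the tuples that do not vanish there.
\<close>

definition glue :: "nat ^ 'm \<Rightarrow> (('k::field, 'n::finite) mpol ^ 'm) set \<Rightarrow> ('k ^ 'n) set \<Rightarrow> ('k ^ 'm) set" where
  "glue w' \<G> P = wpoint w' (SOME y. y \<noteq> 0 \<and> (\<exists>G\<in>\<G>. \<exists>x\<in>P. y = pmap G x))"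

lemma pmap_wscale:
  assumes "\<And>j. whomogeneous w (e * w' $ j) (G $ j)"
  shows "pmap G (wscale w c x) = wscale w' (c ^ e) (pmap G x)"
  using peval_wscale[OF assms]
  by (simp add: vec_eq_iff pmap_def wscale_nth power_mult)

lemma glue_eq:
  assumes atlas: "form_atlas K w V w' V' \<G>" and V: "V \<subseteq> wproj w"
    and P: "P \<in> V" "x \<in> P" and G: "G \<in> \<G>" "pmap G x \<noteq> 0"
  shows "glue w' \<G> P = wpoint w' (pmap G x)"
proof -
  let ?Q = "\<lambda>y. y \<noteq> 0 \<and> (\<exists>G\<in>\<G>. \<exists>x\<in>P. y = pmap G x)"
  have "P \<in> wproj w" using V P(1) by (rule subsetD)
  note P_eq = wproj_rep[OF this P(2)]
  have "?Q (SOME y. ?Q y)" by (rule someI[of ?Q "pmap G x"]) (use P G in blast)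
  then obtain H z where H: "H \<in> \<G>" "z \<in> P" "(SOME y. ?Q y) = pmap H z" "pmap H z \<noteq> 0"
    by auto
  obtain c where c: "z = wscale w c x" "c \<noteq> 0" using H(2) P_eq by (auto simp: wpoint_eq_wscale)
  obtain e where "\<And>j. whomogeneous w (e * w' $ j) (H $ j)"
    using form_atlas_forms[OF atlas H(1)] by blast
  then have z: "pmap H z = wscale w' (c ^ e) (pmap H x)"
    unfolding c(1) by (rule pmap_wscale)
  then have "pmap H x \<noteq> 0" using H(4) c(2) by (simp add: wscale_eq_0_iff)
  then have "wpoint w' (pmap H x) = wpoint w' (pmap G x)"
    using form_atlas_compat[OF atlas P_eq(2)] P(1) G H(1) unfolding P_eq(1) by blast
  then show ?thesis
    using c(2) unfolding glue_def H(3) z by (simp add: wpoint_wscale)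
qed

lemma glue_cases:
  assumes "form_atlas K w V w' V' \<G>" "V \<subseteq> wproj w" "P \<in> V"
  obtains G where "G \<in> \<G>" "\<And>x. x \<in> P \<Longrightarrow> pmap G x \<noteq> 0"
proof -
  obtain z where z: "P = wpoint w z" "z \<noteq> 0" using subsetD[OF assms(2,3)] by (rule wproj_obtain)
  then obtain G where G: "G \<in> \<G>" "pmap G z \<noteq> 0"
    using form_atlas_cover[OF assms(1) z(2)] assms(3) by blast
  obtain e where e: "\<And>j. whomogeneous w (e * w' $ j) (G $ j)"
    using form_atlas_forms[OF assms(1) G(1)] by blast
  have "pmap G x \<noteq> 0" if x: "x \<in> P" for x
  proof -
    obtain c where "x = wscale w c z" "c \<noteq> 0" using x z by (auto simp: wpoint_eq_wscale)
    then show ?thesis using G(2) pmap_wscale[OF e] by (simp add: wscale_eq_0_iff)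
  qed
  with G(1) show thesis by (rule that)
qed

lemma glue_in:
  assumes "form_atlas K w V w' V' \<G>" "V \<subseteq> wproj w" "P \<in> V"
  shows "glue w' \<G> P \<in> V'"
proof -
  obtain G where G: "G \<in> \<G>" "\<And>x. x \<in> P \<Longrightarrow> pmap G x \<noteq> 0"
    using glue_cases[OF assms] by blast
  obtain x where x: "P = wpoint w x" "x \<noteq> 0" using subsetD[OF assms(2,3)] by (rule wproj_obtain)
  then have "x \<in> P" by (simp add: wpoint_self)
  note nz = G(2)[OF this] and eq = glue_eq[OF assms this G(1) G(2)[OF this]]
  show ?thesis
    unfolding eq using form_atlas_target[OF assms(1) x(2) _ G(1) nz] assms(3) x(1) by simp
qed

text \<open>
  Pulling a form back along each tuple gives the pullback of its zero locus: where a tuple vanishes,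
  the pulled back form takes the value at the origin, which is \<open>0\<close> unless the form is constant.
\<close>

lemma glue_vimage_zero_locus:
  assumes atlas: "form_atlas K w V w' V' \<G>" and V: "V \<subseteq> wproj w" "V' \<subseteq> wproj w'"
    and pos: "\<And>j. w' $ j > 0" and S: "\<And>F. F \<in> S \<Longrightarrow> \<exists>d. whomogeneous w' d F"
    and P: "P \<in> V"
  shows "glue w' \<G> P \<in> zero_locus w' S \<longleftrightarrow>
    P \<in> zero_locus w ((\<lambda>(F, G). psubst F G) ` (S \<times> \<G>))"
proof -
  have PV: "P \<in> wproj w" using P V by blast
  have glue: "glue w' \<G> P = wpoint w' (pmap G x)" if "G \<in> \<G>" "x \<in> P" "pmap G x \<noteq> 0" for G x
    using glue_eq[OF atlas V(1) P] that by blast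
  obtain G where G: "G \<in> \<G>" "\<And>x. x \<in> P \<Longrightarrow> pmap G x \<noteq> 0"
    using glue_cases[OF atlas V(1) P] by blast
  obtain x where x: "x \<in> P" using wproj_nonempty[OF PV] by blast
  have iff: "glue w' \<G> P \<in> zero_locus w' S \<longleftrightarrow> (\<forall>F\<in>S. peval F (pmap H y) = 0)"
    if "H \<in> \<G>" "y \<in> P" "pmap H y \<noteq> 0" for H y
    unfolding glue[OF that] using S that(3) by (rule wpoint_in_zero_locus)
  have "glue w' \<G> P \<in> zero_locus w' S \<longleftrightarrow> (\<forall>F\<in>S. \<forall>H\<in>\<G>. \<forall>y\<in>P. peval F (pmap H y) = 0)"
  proof
    assume L: "glue w' \<G> P \<in> zero_locus w' S"
    show "\<forall>F\<in>S. \<forall>H\<in>\<G>. \<forall>y\<in>P. peval F (pmap H y) = 0"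
    proof (intro ballI)
      fix F H y assume F: "F \<in> S" and H: "H \<in> \<G>" "y \<in> P"
      show "peval F (pmap H y) = 0"
      proof (cases "pmap H y = 0")
        case True
        obtain d where "whomogeneous w' d F" using S F by blast
        then have "peval F 0 = 0 \<or> peval F 0 = peval F (pmap G x)"
          using whomogeneous_origin[OF pos] whomogeneous_degree_0[OF pos] by metis
        then show ?thesis using True iff[OF G(1) x G(2)[OF x]] L F by auto
      qed (use iff[OF H] L F in blast)
    qed
  qed (use iff[OF G(1) x G(2)[OF x]] G x in blast)
  then show ?thesis using PV by (auto simp: zero_locus_def)
qed

lemma glue_vimage_zopen:
  assumes atlas: "form_atlas K w V w' V' \<G>" and V: "V \<subseteq> wproj w" "V' \<subseteq> wproj w'"
    and pos: "\<And>j. w' $ j > 0" and K: "subring_set K" and U: "zopen_in K w' V' U"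
  shows "zopen_in K w V (V \<inter> glue w' \<G> -` U)"
proof -
  obtain S where forms: "\<forall>F\<in>S. defined_over K F \<and> (\<exists>d. whomogeneous w' d F)"
    and U_eq: "U = V' - zero_locus w' S"
    using U unfolding zopen_in_def zclosed_def by (elim exE conjE) simp
  have S: "\<And>F. F \<in> S \<Longrightarrow> defined_over K F" "\<And>F. F \<in> S \<Longrightarrow> \<exists>d. whomogeneous w' d F"
    using forms by simp_all
  let ?S = "(\<lambda>(F, G). psubst F G) ` (S \<times> \<G>)"
  have "defined_over K F \<and> (\<exists>d. whomogeneous w d F)" if mem: "F \<in> ?S" for F
  proof -
    obtain F' G where F: "F = psubst F' G" "F' \<in> S" "G \<in> \<G>" using mem by auto
    obtain e where e: "\<And>j. defined_over K (G $ j)" "\<And>j. whomogeneous w (e * w' $ j) (G $ j)"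
      using form_atlas_forms[OF atlas F(3)] by blast
    obtain d where d: "whomogeneous w' d F'" using S(2)[OF F(2)] by blast
    have "defined_over K F"
      unfolding F(1) by (rule defined_over_psubst[OF K S(1)[OF F(2)] e(1)])
    moreover have "whomogeneous w (e * d) F"
      unfolding F(1) by (rule whomogeneous_psubst[OF d e(2)])
    ultimately show ?thesis by blast
  qed
  then have "zclosed K w (zero_locus w ?S)"
    unfolding zclosed_def by (intro exI[of _ ?S] conjI[OF _ refl] ballI)
  moreover have "V \<inter> glue w' \<G> -` U = V - zero_locus w ?S"
  proof (rule set_eqI)
    fix P
    show "P \<in> V \<inter> glue w' \<G> -` U \<longleftrightarrow> P \<in> V - zero_locus w ?S"
    proof (cases "P \<in> V")
      case True
      show ?thesis
        by (simp only: Int_iff Diff_iff vimage_eq U_eq glue_in[OF atlas V(1) True] simp_thms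
              glue_vimage_zero_locus[OF atlas V pos S(2) True])
    qed simp
  qed
  ultimately show ?thesis
    unfolding zopen_in_def by (intro exI[of _ "zero_locus w ?S"] conjI)
qed

text \<open>
  Near a given point, substitute a tuple that does not vanish there into numerator and denominator.
\<close>

lemma glue_regular:
  assumes atlas: "form_atlas K w V w' V' \<G>" and V: "V \<subseteq> wproj w" "V' \<subseteq> wproj w'"
    and pos: "\<And>j. w' $ j > 0" and K: "subring_set K" and g: "regular_on K w' U g" and UV: "U \<subseteq> V'"
  shows "regular_on K w (V \<inter> glue w' \<G> -` U) (g \<circ> glue w' \<G>)"
  unfolding regular_on_def
proof
  fix P assume P: "P \<in> V \<inter> glue w' \<G> -` U"
  have val: "pmap G x \<in> glue w' \<G> Q" if "Q \<in> V" "x \<in> Q" "G \<in> \<G>" "pmap G x \<noteq> 0" for Q x G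
    using glue_eq[OF atlas V(1)] that wpoint_self by metis
  obtain G where G: "G \<in> \<G>" "\<And>x. x \<in> P \<Longrightarrow> pmap G x \<noteq> 0"
    using glue_cases[OF atlas V(1)] P by blast
  obtain e where e: "\<And>j. defined_over K (G $ j)" "\<And>j. whomogeneous w (e * w' $ j) (G $ j)"
    using form_atlas_forms[OF atlas G(1)] by blast
  obtain d A B where AB: "defined_over K A" "defined_over K B"
      "whomogeneous w' d A" "whomogeneous w' d B" "\<forall>y\<in>glue w' \<G> P. peval B y \<noteq> 0"
      "\<forall>Q\<in>U. \<forall>y\<in>Q. peval B y \<noteq> 0 \<longrightarrow> g Q = peval A y / peval B y"
    using g P unfolding regular_on_def by blast
  have "(g \<circ> glue w' \<G>) Q = peval A (pmap G x) / peval B (pmap G x)"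
    if Q: "Q \<in> V \<inter> glue w' \<G> -` U" "x \<in> Q" "peval B (pmap G x) \<noteq> 0" for Q x
  proof (cases "pmap G x = 0")
    case False
    then have "pmap G x \<in> glue w' \<G> Q" using val Q G(1) by blast
    then show ?thesis using Q AB(6) by auto
  next
    case True
    (* Here B does not vanish at the origin, so A and B are constants. *)
    then have d: "d = 0" using whomogeneous_origin[OF pos AB(4)] Q(3) by auto
    obtain y where y: "y \<in> glue w' \<G> Q"
      using wproj_nonempty Q V(2) UV by fastforce
    have "peval A (pmap G x) = peval A y" "peval B (pmap G x) = peval B y"
      by (rule whomogeneous_degree_0[OF pos], use AB(3,4) d in simp)+
    then show ?thesis using Q y AB(6) by auto
  qed
  moreover have "peval B (pmap G x) \<noteq> 0" if "x \<in> P" for x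
    using AB(5) val[OF _ that G(1) G(2)[OF that]] P by blast
  moreover have "defined_over K (psubst A G)" "defined_over K (psubst B G)"
      "whomogeneous w (e * d) (psubst A G)" "whomogeneous w (e * d) (psubst B G)"
    by (rule defined_over_psubst[OF K AB(1) e(1)] defined_over_psubst[OF K AB(2) e(1)]
          whomogeneous_psubst[OF AB(3) e(2)] whomogeneous_psubst[OF AB(4) e(2)])+
  ultimately show "\<exists>d A B. defined_over K A \<and> defined_over K B \<and>
      whomogeneous w d A \<and> whomogeneous w d B \<and> (\<forall>x\<in>P. peval B x \<noteq> 0) \<and>
      (\<forall>Q\<in>V \<inter> glue w' \<G> -` U. \<forall>x\<in>Q. peval B x \<noteq> 0 \<longrightarrow>
         (g \<circ> glue w' \<G>) Q = peval A x / peval B x)"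
    by (intro exI[of _ "e * d"] exI[of _ "psubst A G"] exI[of _ "psubst B G"] conjI ballI impI)
       (simp_all only: peval_psubst, auto)
qed

lemma morphism_over_glue:
  assumes "form_atlas K w V w' V' \<G>" "V \<subseteq> wproj w" "V' \<subseteq> wproj w'"
    and "\<And>j. w' $ j > 0" "subring_set K"
  shows "morphism_over K w V w' V' (glue w' \<G>)"
  unfolding morphism_over_def
proof (intro conjI allI impI)
  show "glue w' \<G> ` V \<subseteq> V'"
    using glue_in[OF assms(1,2)] by blast
  show "zopen_in K w V (V \<inter> glue w' \<G> -` U)" if "zopen_in K w' V' U" for U
    by (rule glue_vimage_zopen[OF assms that])
  show "regular_on K w (V \<inter> glue w' \<G> -` U) (g \<circ> glue w' \<G>)"
    if "zopen_in K w' V' U \<and> regular_on K w' U g" for U g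
    using that by (intro glue_regular[OF assms]) (auto simp: zopen_in_def)
qed

lemma form_atlas_UNIV:
  assumes "form_atlas K w V w' V' \<G>"
  shows "form_atlas UNIV w V w' V' \<G>"
proof -
  have "\<forall>G\<in>\<G>. \<exists>e. \<forall>j. defined_over UNIV (G $ j) \<and> whomogeneous w (e * w' $ j) (G $ j)"
    using form_atlas_forms[OF assms] by (simp add: defined_over_def) blast
  then show ?thesis
    using assms unfolding form_atlas_def by (elim conjE, intro conjI)
qed

text \<open>
  Irreducibility is a topological property, preserved by continuous images.
\<close>

lemma zirreducible_image:
  assumes irr: "zirreducible w V" and f: "morphism_over UNIV w V w' V' f" "f ` V = V'"
  shows "zirreducible w' V'"
proof -
  have pull: "\<exists>Z'. zclosed UNIV w Z' \<and> (\<forall>P\<in>V. P \<in> Z' \<longleftrightarrow> f P \<in> Z)" if "zclosed UNIV w' Z" for Z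
  proof -
    have "zopen_in UNIV w V (V \<inter> f -` (V' - Z))"
      using f(1) that unfolding morphism_over_def zopen_in_def by blast
    then obtain Z' where "zclosed UNIV w Z'" "V \<inter> f -` (V' - Z) = V - Z'"
      by (auto simp: zopen_in_def)
    then show ?thesis using f(2) by (intro exI[of _ Z']) blast
  qed
  have "V' \<subseteq> Z1 \<or> V' \<subseteq> Z2"
    if Z: "zclosed UNIV w' Z1" "zclosed UNIV w' Z2" "V' \<subseteq> Z1 \<union> Z2" for Z1 Z2
  proof -
    obtain Z1' Z2' where Z': "zclosed UNIV w Z1'" "\<forall>P\<in>V. P \<in> Z1' \<longleftrightarrow> f P \<in> Z1"
        "zclosed UNIV w Z2'" "\<forall>P\<in>V. P \<in> Z2' \<longleftrightarrow> f P \<in> Z2"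
      using pull Z(1,2) by meson
    then have "V \<subseteq> Z1' \<union> Z2'" using Z(3) f(2) by blast
    then have "V \<subseteq> Z1' \<or> V \<subseteq> Z2'" using irr Z'(1,3) by (simp add: zirreducible_def)
    then show ?thesis using Z'(2,4) f(2) by blast
  qed
  then show ?thesis using irr f(2) unfolding zirreducible_def by blast
qed

section \<open>Functions on the double cover\<close>

text \<open>
  Since \<open>v\<^sup>2\<close> is a polynomial in \<open>t\<close> on the curve, all polynomial functions on it have this form.
  Only values on the curve count, so \<open>a\<close> and \<open>b\<close> need not represent \<open>g\<close> elsewhere.
\<close>

definition linear_in_v :: "'k::comm_ring_1 poly \<Rightarrow> ('k \<Rightarrow> 'k \<Rightarrow> 'k) \<Rightarrow> bool" where
  "linear_in_v f g \<longleftrightarrow> (\<exists>a b. \<forall>t v. v\<^sup>2 = poly f t \<longrightarrow> g t v = poly a t + poly b t * v)"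

lemma linear_in_v_poly: "linear_in_v f (\<lambda>t v. poly p t)"
  unfolding linear_in_v_def by (rule exI[of _ p], rule exI[of _ 0]) simp

lemma linear_in_v_const: "linear_in_v f (\<lambda>t v. c)"
  using linear_in_v_poly[of f "[:c:]"] by simp

lemma linear_in_v_base: "linear_in_v f (\<lambda>t v. t)"
  using linear_in_v_poly[of f "[:0, 1:]"] by simp

lemma linear_in_v_v: "linear_in_v f (\<lambda>t v. v)"
  unfolding linear_in_v_def by (rule exI[of _ 0], rule exI[of _ 1]) simp

lemma linear_in_v_add:
  assumes "linear_in_v f g" "linear_in_v f h"
  shows "linear_in_v f (\<lambda>t v. g t v + h t v)"
proof -
  obtain a b c d where "\<forall>t v. v\<^sup>2 = poly f t \<longrightarrow> g t v = poly a t + poly b t * v"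
      "\<forall>t v. v\<^sup>2 = poly f t \<longrightarrow> h t v = poly c t + poly d t * v"
    using assms by (auto simp: linear_in_v_def)
  then show ?thesis
    unfolding linear_in_v_def
    by (intro exI[of _ "a + c"] exI[of _ "b + d"]) (simp add: algebra_simps)
qed

lemma linear_in_v_mult:
  assumes "linear_in_v f g" "linear_in_v f h"
  shows "linear_in_v f (\<lambda>t v. g t v * h t v)"
proof -
  obtain a b c d where ab: "\<And>t v. v\<^sup>2 = poly f t \<Longrightarrow> g t v = poly a t + poly b t * v"
      and cd: "\<And>t v. v\<^sup>2 = poly f t \<Longrightarrow> h t v = poly c t + poly d t * v"
    using assms by (auto simp: linear_in_v_def)
  have "g t v * h t v = poly (a * c + b * d * f) t + poly (a * d + b * c) t * v"
    if v: "v\<^sup>2 = poly f t" for t v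
    unfolding ab[OF v] cd[OF v] by (simp add: v[symmetric] algebra_simps power2_eq_square)
  then show ?thesis unfolding linear_in_v_def by blast
qed

lemma linear_in_v_power: "linear_in_v f g \<Longrightarrow> linear_in_v f (\<lambda>t v. g t v ^ n)"
  by (induction n) (simp_all add: linear_in_v_const linear_in_v_mult)

lemma linear_in_v_prod:
  "(\<And>i. i \<in> A \<Longrightarrow> linear_in_v f (g i)) \<Longrightarrow> linear_in_v f (\<lambda>t v. \<Prod>i\<in>A. g i t v)"
  by (induction A rule: infinite_finite_induct)
     (simp_all add: linear_in_v_const linear_in_v_mult)

lemma linear_in_v_peval:
  assumes "\<And>i. linear_in_v f (\<lambda>t v. \<xi> t v $ i)"
  shows "linear_in_v f (\<lambda>t v. peval F (\<xi> t v))"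
proof (induction F rule: mpol_induct)
  case (single m c)
  show ?case
    unfolding peval_single
    by (intro linear_in_v_mult linear_in_v_const linear_in_v_prod linear_in_v_power assms)
next
  case (add p q)
  then show ?case by (simp add: linear_in_v_add)
qed

text \<open>
  At a simple root of \<open>f\<close>, a nonzero square vanishes to even order and \<open>f\<close> times a square to odd
  order.
\<close>

lemma square_eq_simple_root_times_square:
  fixes a b f :: "'k::field_char_0 poly"
  assumes r: "poly f r = 0" "poly (pderiv f) r \<noteq> 0" and eq: "a\<^sup>2 = f * b\<^sup>2"
  shows "a = 0" "b = 0"
proof -
  have f0: "f \<noteq> 0" using r(2) by auto
  have "pderiv f \<noteq> 0" using r(2) by auto
  then have "order r f = Suc (order r (pderiv f))"
    using r(1) f0 by (intro order_pderiv) (auto simp: order_root)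
  then have f1: "order r f = 1" using r(2) by (simp add: order_0I)
  show b: "b = 0"
  proof (rule ccontr)
    assume "b \<noteq> 0"
    then have "a \<noteq> 0" using eq f0 by auto
    have "order r (a * a) = order r (f * (b * b))" using eq by (simp add: power2_eq_square)
    then have "2 * order r a = 1 + 2 * order r b"
      using \<open>a \<noteq> 0\<close> \<open>b \<noteq> 0\<close> f0 f1 by (simp add: order_mult)
    then show False by presburger
  qed
  then show "a = 0" using eq by simp
qed

text \<open>
  The norm \<open>a\<^sup>2 - f b\<^sup>2\<close> of \<open>a + b v\<close> is multiplicative and vanishes only for \<open>a = b = 0\<close>. The
  product of the norms of \<open>g\<close> and \<open>h\<close> has \<open>g h\<close> as a factor, so it vanishes for all \<open>t\<close> and is
  the zero polynomial.
\<close>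

lemma linear_in_v_zero_product:
  fixes f :: "'k::{alg_closed_field, field_char_0} poly"
  assumes r: "poly f r = 0" "poly (pderiv f) r \<noteq> 0"
    and lin: "linear_in_v f g" "linear_in_v f h"
    and zero: "\<And>t v. v\<^sup>2 = poly f t \<Longrightarrow> g t v * h t v = 0"
  shows "(\<forall>t v. v\<^sup>2 = poly f t \<longrightarrow> g t v = 0) \<or> (\<forall>t v. v\<^sup>2 = poly f t \<longrightarrow> h t v = 0)"
proof -
  obtain a b c d where ab: "\<And>t v. v\<^sup>2 = poly f t \<Longrightarrow> g t v = poly a t + poly b t * v"
      and cd: "\<And>t v. v\<^sup>2 = poly f t \<Longrightarrow> h t v = poly c t + poly d t * v"
    using lin by (auto simp: linear_in_v_def)
  have "poly ((a\<^sup>2 - f * b\<^sup>2) * (c\<^sup>2 - f * d\<^sup>2)) t = 0" for t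
  proof -
    obtain v where v: "v\<^sup>2 = poly f t" using nth_root_exists[of 2 "poly f t"] by auto
    have "poly ((a\<^sup>2 - f * b\<^sup>2) * (c\<^sup>2 - f * d\<^sup>2)) t =
        (g t v * h t v) * ((poly a t - poly b t * v) * (poly c t - poly d t * v))"
      unfolding ab[OF v] cd[OF v] poly_mult poly_diff poly_power v[symmetric] by algebra
    then show ?thesis using zero[OF v] by simp
  qed
  then have "(a\<^sup>2 - f * b\<^sup>2) * (c\<^sup>2 - f * d\<^sup>2) = 0"
    using poly_all_0_iff_0 by blast
  then have "a\<^sup>2 = f * b\<^sup>2 \<or> c\<^sup>2 = f * d\<^sup>2" by simp
  then have "a = 0 \<and> b = 0 \<or> c = 0 \<and> d = 0"
    using square_eq_simple_root_times_square[OF r] by blast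
  then show ?thesis using ab cd by auto
qed

section \<open>The two curves\<close>

lemma vec3_cases:
  obtains a b c where "(x :: 'a::zero ^ 3) = vector [a, b, c]"
proof -
  have "x = vector [x $ 1, x $ 2, x $ 3]" by (simp add: vec_eq_iff forall_3)
  then show thesis by (rule that)
qed

lemma vec3_eq_iff: "vector [a, b, c] = (vector [a', b', c'] :: 'a::zero ^ 3) \<longleftrightarrow> a = a' \<and> b = b' \<and> c = c'"
  by (simp add: vec_eq_iff forall_3)

lemma vec3_eq_0_iff: "vector [a, b, c] = (0 :: 'a::zero ^ 3) \<longleftrightarrow> a = 0 \<and> b = 0 \<and> c = 0"
  by (simp add: vec_eq_iff forall_3)

lemma wscale_wC: "wscale wC c (vector [y, v, z]) = vector [c * y, c\<^sup>2 * v, c * z]"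
  by (simp add: vec_eq_iff forall_3 wscale_nth wC_def)

lemma wscale_wE: "wscale wE c (vector [X, Y, Z]) = vector [c * X, c * Y, c * Z]"
  by (simp add: vec_eq_iff forall_3 wscale_nth wE_def)

lemma pmap_vec3: "pmap (vector [p, q, r]) x = (vector [peval p x, peval q x, peval r x] :: 'k::comm_ring_1 ^ 3)"
  by (simp add: vec_eq_iff forall_3 pmap_def)

lemma wC_nth: "wC $ 1 = 1" "wC $ 2 = 2" "wC $ 3 = 1"
  by (simp_all add: wC_def)

lemma wE_nth: "wE $ i = 1"
  using exhaust_3[of i] by (auto simp: wE_def)

lemma wC_pos: "wC $ i > 0"
  using exhaust_3[of i] by (auto simp: wC_def)

lemma wE_pos: "wE $ i > 0"
  by (simp add: wE_nth)

lemma whomogeneous_mult':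
  "whomogeneous w d p \<Longrightarrow> whomogeneous w e q \<Longrightarrow> d + e = n \<Longrightarrow> whomogeneous w n (p * q)"
  using whomogeneous_mult by blast

lemma whomogeneous_C_poly: "whomogeneous wC 4 (C_poly :: ('k::field, 3) mpol)"
proof -
  note var = whomogeneous_power[OF whomogeneous_var, where w = wC]
  have "whomogeneous wC 4 ((var 2)^2 :: ('k, 3) mpol)"
    using var[of 2 2] by (simp add: wC_nth)
  moreover have "whomogeneous wC 4 (16 * (var 1)^4 :: ('k, 3) mpol)"
    by (rule whomogeneous_mult'[OF whomogeneous_numeral var]) (simp add: wC_nth)
  moreover have "whomogeneous wC 4 (136 * (var 1)^2 * (var 3)^2 :: ('k, 3) mpol)"
    by (rule whomogeneous_mult'[OF whomogeneous_mult[OF whomogeneous_numeral var] var])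
       (simp add: wC_nth)
  moreover have "whomogeneous wC 4 ((var 3)^4 :: ('k, 3) mpol)"
    using var[of 4 3] by (simp add: wC_nth)
  ultimately show ?thesis
    unfolding C_poly_def by (intro whomogeneous_diff whomogeneous_add)
qed

lemma whomogeneous_wE_linear: "whomogeneous wE 1 (var 1 - numeral n * var 3 :: ('k::field, 3) mpol)"
proof (rule whomogeneous_diff)
  show "whomogeneous wE 1 (var 1 :: ('k, 3) mpol)"
    using whomogeneous_var[of wE 1] by (simp add: wE_nth)
  show "whomogeneous wE 1 (numeral n * var 3 :: ('k, 3) mpol)"
    by (rule whomogeneous_mult'[OF whomogeneous_numeral whomogeneous_var]) (simp add: wE_nth)
qed

lemma whomogeneous_E_poly: "whomogeneous wE 3 (E_poly :: ('k::field, 3) mpol)"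
  unfolding E_poly_def
proof (rule whomogeneous_diff)
  show "whomogeneous wE 3 ((var 2)^2 * var 3 :: ('k, 3) mpol)"
    by (rule whomogeneous_mult'[OF whomogeneous_power[OF whomogeneous_var] whomogeneous_var])
       (simp add: wE_nth)
  show "whomogeneous wE 3 (var 1 * (var 1 - 8 * var 3) * (var 1 - 9 * var 3) :: ('k, 3) mpol)"
    by (rule whomogeneous_mult'[OF whomogeneous_mult[OF whomogeneous_var whomogeneous_wE_linear]
          whomogeneous_wE_linear]) (simp add: wE_nth)
qed

lemma peval_C_poly: "peval C_poly (vector [y, v, z]) = v\<^sup>2 - (16 * y^4 + 136 * y\<^sup>2 * z\<^sup>2 + z^4)"
  by (simp add: C_poly_def)

lemma peval_E_poly: "peval E_poly (vector [X, Y, Z]) = Y\<^sup>2 * Z - X * (X - 8 * Z) * (X - 9 * Z)"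
  by (simp add: E_poly_def)

lemma wpoint_in_C_bar:
  "x \<noteq> 0 \<Longrightarrow> wpoint wC x \<in> C_bar \<longleftrightarrow> peval C_poly x = 0"
  unfolding C_bar_def using whomogeneous_C_poly by (subst wpoint_in_zero_locus) auto

lemma wpoint_in_E_curve:
  "x \<noteq> 0 \<Longrightarrow> wpoint wE x \<in> E_curve \<longleftrightarrow> peval E_poly x = 0"
  unfolding E_curve_def using whomogeneous_E_poly by (subst wpoint_in_zero_locus) auto

lemma C_bar_subset: "C_bar \<subseteq> wproj wC"
  by (simp add: C_bar_def zero_locus_subset_wproj)

lemma E_curve_subset: "E_curve \<subseteq> wproj wE"
  by (simp add: E_curve_def zero_locus_subset_wproj)

lemma C_pt_in_C_bar: "(y, v) \<in> C_aff \<Longrightarrow> C_pt y v 1 \<in> C_bar"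
  by (simp add: C_pt_def wpoint_in_C_bar vec3_eq_0_iff peval_C_poly C_aff_def)

lemma C_pt_infinity_in_C_bar: "C_pt 1 4 0 \<in> C_bar" "C_pt 1 (- 4) 0 \<in> C_bar"
  by (simp_all add: C_pt_def wpoint_in_C_bar vec3_eq_0_iff peval_C_poly)

text \<open>
  At infinity the equation becomes \<open>v\<^sup>2 = 16 y\<^sup>4\<close>; it excludes \<open>y = z = 0\<close>, the singular point
  of the ambient weighted projective plane.
\<close>

lemma C_bar_cases:
  assumes "P \<in> C_bar"
  obtains (affine) y v where "(y, v) \<in> C_aff" "P = C_pt y v 1"
  | (plus) "P = C_pt 1 4 0" | (minus) "P = C_pt 1 (- 4) 0"
proof -
  obtain x where x: "P = wpoint wC x" "x \<noteq> 0"
    using assms C_bar_subset by (auto elim: wproj_obtain)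
  obtain y v z where yvz: "x = vector [y, v, z]" by (rule vec3_cases)
  have eq: "v\<^sup>2 = 16 * y^4 + 136 * y\<^sup>2 * z\<^sup>2 + z^4"
    using assms x(2) unfolding x(1) yvz by (simp add: wpoint_in_C_bar peval_C_poly)
  show thesis
  proof (cases "z = 0")
    case False
    have "P = C_pt (y / z) (v / z\<^sup>2) 1"
      unfolding x(1) yvz C_pt_def
      by (rule wpoint_eqI[of z]) (use False in \<open>simp_all add: wscale_wC\<close>)
    moreover have "(y / z, v / z\<^sup>2) \<in> C_aff"
      using False eq by (simp add: C_aff_def power_divide power_mult[symmetric] field_simps)
    ultimately show thesis by (rule affine[rotated])
  next
    case z: True
    with eq have v: "v\<^sup>2 = 16 * y^4" by simp
    have y: "y \<noteq> 0" using x(2) v z by (auto simp: yvz vec3_eq_0_iff)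
    have "(v - 4 * y\<^sup>2) * (v + 4 * y\<^sup>2) = v\<^sup>2 - 16 * y^4" by algebra
    then have "v = 4 * y\<^sup>2 \<or> v = - (4 * y\<^sup>2)"
      using v by (simp add: eq_neg_iff_add_eq_0)
    then show thesis
    proof
      assume "v = 4 * y\<^sup>2"
      then have "P = C_pt 1 4 0"
        unfolding x(1) yvz C_pt_def z
        by (intro wpoint_eqI[of y]) (use y in \<open>simp_all add: wscale_wC mult.commute\<close>)
      then show thesis by (rule plus)
    next
      assume "v = - (4 * y\<^sup>2)"
      then have "P = C_pt 1 (- 4) 0"
        unfolding x(1) yvz C_pt_def z
        by (intro wpoint_eqI[of y]) (use y in \<open>simp_all add: wscale_wC mult.commute\<close>)
      then show thesis by (rule minus)
    qed
  qed
qed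

lemma E_curve_cases:
  assumes "P \<in> E_curve"
  obtains (affine) X Y where "(X, Y) \<in> E_aff" "P = E_pt X Y 1" | (infinity) "P = E_pt 0 1 0"
proof -
  obtain x where x: "P = wpoint wE x" "x \<noteq> 0"
    using assms E_curve_subset by (auto elim: wproj_obtain)
  obtain X Y Z where XYZ: "x = vector [X, Y, Z]" by (rule vec3_cases)
  have eq: "Y\<^sup>2 * Z = X * (X - 8 * Z) * (X - 9 * Z)"
    using assms x(2) unfolding x(1) XYZ by (simp add: wpoint_in_E_curve peval_E_poly)
  show thesis
  proof (cases "Z = 0")
    case False
    have "P = E_pt (X / Z) (Y / Z) 1"
      unfolding x(1) XYZ E_pt_def
      by (rule wpoint_eqI[of Z]) (use False in \<open>simp_all add: wscale_wE\<close>)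
    moreover have "(X / Z, Y / Z) \<in> E_aff"
    proof -
      have "(Y / Z)\<^sup>2 = Y\<^sup>2 * Z / Z^3"
        using False by (simp add: power2_eq_square power3_eq_cube)
      also have "\<dots> = (X / Z) * ((X - 8 * Z) / Z) * ((X - 9 * Z) / Z)"
        unfolding eq by (simp add: power3_eq_cube)
      also have "\<dots> = (X / Z) * (X / Z - 8) * (X / Z - 9)"
        using False by (simp add: diff_divide_distrib)
      finally show ?thesis by (simp add: E_aff_def)
    qed
    ultimately show thesis by (rule affine[rotated])
  next
    case True
    with eq have X: "X = 0" by simp
    have Y: "Y \<noteq> 0" using x(2) X True by (auto simp: XYZ vec3_eq_0_iff)
    have "P = E_pt 0 1 0"
      unfolding x(1) XYZ E_pt_def X True
      by (rule wpoint_eqI[of Y]) (use Y in \<open>simp_all add: wscale_wE\<close>)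
    then show thesis by (rule infinity)
  qed
qed

section \<open>Irreducibility and smoothness\<close>

text \<open>
  The right-hand sides of the equation on the charts \<open>z = 1\<close> and \<open>y = 1\<close>.
\<close>

definition quartic :: "'k::field poly" where "quartic = [:1, 0, 136, 0, 16:]"

definition quartic_rev :: "'k::field poly" where "quartic_rev = [:16, 0, 136, 0, 1:]"

lemma poly_quartic: "poly quartic t = 16 * t^4 + 136 * t\<^sup>2 + 1"
  by (simp add: quartic_def algebra_simps power2_eq_square power4_eq_xxxx)

lemma poly_quartic_rev: "poly quartic_rev t = 16 + 136 * t\<^sup>2 + t^4"
  by (simp add: quartic_rev_def algebra_simps power2_eq_square power4_eq_xxxx)

lemma poly_pderiv_quartic: "poly (pderiv quartic) t = 16 * (t * (4 * t\<^sup>2 + 17))"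
  by (simp add: quartic_def pderiv_pCons algebra_simps power2_eq_square)

lemma poly_pderiv_quartic_rev: "poly (pderiv quartic_rev) t = 4 * (t * (t\<^sup>2 + 68))"
  by (simp add: quartic_rev_def pderiv_pCons algebra_simps power2_eq_square)

text \<open>
  The nonzero critical points satisfy \<open>4 t\<^sup>2 = -17\<close>, so completing the square shows the critical
  value. The reversed quartic is treated in the same way.
\<close>

lemma quartic_simple_roots:
  fixes t :: "'k::field_char_0"
  assumes "poly quartic t = 0"
  shows "poly (pderiv quartic) t \<noteq> 0"
proof
  assume "poly (pderiv quartic) t = 0"
  then consider "t = 0" | "4 * t\<^sup>2 + 17 = 0" by (auto simp: poly_pderiv_quartic)
  then show False
  proof cases
    case 1
    then show False using assms by (simp add: poly_quartic)
  next
    case 2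
    have "poly quartic t = (4 * t\<^sup>2 + 17)\<^sup>2 - 288"
      by (simp add: poly_quartic algebra_simps power2_eq_square power4_eq_xxxx)
    then show False unfolding 2 using assms by simp
  qed
qed

lemma quartic_rev_simple_roots:
  fixes t :: "'k::field_char_0"
  assumes "poly quartic_rev t = 0"
  shows "poly (pderiv quartic_rev) t \<noteq> 0"
proof
  assume "poly (pderiv quartic_rev) t = 0"
  then consider "t = 0" | "t\<^sup>2 + 68 = 0" by (auto simp: poly_pderiv_quartic_rev)
  then show False
  proof cases
    case 1
    then show False using assms by (simp add: poly_quartic_rev)
  next
    case 2
    have "poly quartic_rev t = (t\<^sup>2 + 68)\<^sup>2 - 4608"
      by (simp add: poly_quartic_rev algebra_simps power2_eq_square power4_eq_xxxx)
    then show False unfolding 2 using assms by simp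
  qed
qed

lemma linear_in_v_vec3:
  assumes "linear_in_v f (\<lambda>t v. a t v)" "linear_in_v f (\<lambda>t v. b t v)" "linear_in_v f (\<lambda>t v. c t v)"
  shows "linear_in_v f (\<lambda>t v. peval F (vector [a t v, b t v, c t v] :: 'k::field ^ 3))"
proof (rule linear_in_v_peval)
  fix i :: 3
  show "linear_in_v f (\<lambda>t v. (vector [a t v, b t v, c t v] :: 'k ^ 3) $ i)"
    using exhaust_3[of i] assms by auto
qed

lemma quartic_chart_zero_product:
  fixes F G :: "('k::{alg_closed_field, field_char_0}, 3) mpol"
  assumes "\<And>y v. (y, v) \<in> C_aff \<Longrightarrow> peval F (vector [y, v, 1]) * peval G (vector [y, v, 1]) = 0"
  shows "(\<forall>(y, v)\<in>C_aff. peval F (vector [y, v, 1]) = 0) \<or>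
    (\<forall>(y, v)\<in>C_aff. peval G (vector [y, v, 1]) = 0)"
proof -
  obtain r :: 'k where r: "poly quartic r = 0"
    using alg_closed_imp_poly_has_root[of "quartic :: 'k poly"] by (auto simp: quartic_def)
  have C_aff: "(t, v) \<in> C_aff \<longleftrightarrow> v\<^sup>2 = poly quartic t" for t v :: 'k
    by (simp add: C_aff_def poly_quartic)
  show ?thesis
    using linear_in_v_zero_product[OF r quartic_simple_roots[OF r],
        of "\<lambda>t v. peval F (vector [t, v, 1])" "\<lambda>t v. peval G (vector [t, v, 1])"] assms
    unfolding Ball_def split_paired_All case_prod_conv C_aff
    by (simp add: linear_in_v_vec3 linear_in_v_base linear_in_v_v linear_in_v_const)
qed

text \<open>
  The product of \<open>F\<close> with the coordinate \<open>z\<close> vanishes on the chart \<open>y = 1\<close>. This chart is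
  irreducible as well and \<open>z\<close> does not vanish identically there, so \<open>F\<close> vanishes there.
\<close>

lemma vanishes_on_C_bar_if_on_C_aff:
  fixes F :: "('k::{alg_closed_field, field_char_0}, 3) mpol"
  assumes F: "whomogeneous wC d F" and zero: "\<And>y v. (y, v) \<in> C_aff \<Longrightarrow> peval F (vector [y, v, 1]) = 0"
    and P: "P \<in> C_bar" "x \<in> P"
  shows "peval F x = 0"
proof -
  have on_pt: "peval F x = 0" if "P = wpoint wC u" "peval F u = 0" for u
    using whomogeneous_vanishes_on_wpoint[OF F that(2)] P(2) that(1) by blast
  obtain r :: 'k where r: "poly quartic_rev r = 0"
    using alg_closed_imp_poly_has_root[of "quartic_rev :: 'k poly"] by (auto simp: quartic_rev_def)
  have prod0: "peval F (vector [1, v, t]) * t = 0" if v: "v\<^sup>2 = poly quartic_rev t" for t v :: 'k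
  proof (cases "t = 0")
    case False
    have "(1 / t, v / t\<^sup>2) \<in> C_aff"
      using False v by (simp add: C_aff_def poly_quartic_rev power_divide power_mult[symmetric] field_simps)
    moreover have "vector [1, v, t] = wscale wC t (vector [1 / t, v / t\<^sup>2, 1])"
      using False by (simp add: wscale_wC)
    ultimately show ?thesis using zero peval_wscale[OF F] by simp
  qed simp
  have "(\<forall>t v. v\<^sup>2 = poly quartic_rev t \<longrightarrow> peval F (vector [1, v, t]) = 0) \<or>
      (\<forall>t v :: 'k. v\<^sup>2 = poly quartic_rev t \<longrightarrow> t = 0)"
    using prod0
    by (intro linear_in_v_zero_product[OF r quartic_rev_simple_roots[OF r]] linear_in_v_vec3
          linear_in_v_base linear_in_v_v linear_in_v_const)
  moreover obtain s :: 'k where "s\<^sup>2 = poly quartic_rev 1"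
    using nth_root_exists[of 2 "poly quartic_rev 1"] by auto
  ultimately have rev: "peval F (vector [1, v, t]) = 0" if "v\<^sup>2 = poly quartic_rev t" for t v :: 'k
    using that by (metis zero_neq_one)
  from P(1) show ?thesis
  proof (cases rule: C_bar_cases)
    case (affine y v)
    then show ?thesis using on_pt zero by (simp add: C_pt_def)
  next
    case plus
    then show ?thesis using on_pt rev[of 4 0] by (simp add: C_pt_def poly_quartic_rev)
  next
    case minus
    then show ?thesis using on_pt rev[of "- 4" 0] by (simp add: C_pt_def poly_quartic_rev)
  qed
qed

lemma C_bar_subset_zero_locus:
  fixes S :: "('k::{alg_closed_field, field_char_0}, 3) mpol set"
  assumes "\<And>F. F \<in> S \<Longrightarrow> \<exists>d. whomogeneous wC d F"
    and "\<And>F y v. F \<in> S \<Longrightarrow> (y, v) \<in> C_aff \<Longrightarrow> peval F (vector [y, v, 1]) = 0"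
  shows "C_bar \<subseteq> zero_locus wC S"
proof
  fix P :: "('k ^ 3) set" assume P: "P \<in> C_bar"
  have "peval F x = 0" if "F \<in> S" "x \<in> P" for F x
  proof -
    obtain d where "whomogeneous wC d F" using assms(1) \<open>F \<in> S\<close> by blast
    then show ?thesis
      using vanishes_on_C_bar_if_on_C_aff[OF _ assms(2)[OF \<open>F \<in> S\<close>] P \<open>x \<in> P\<close>] by blast
  qed
  then show "P \<in> zero_locus wC S"
    using P C_bar_subset by (auto simp: zero_locus_def)
qed

lemma C_pt_in_zero_locus:
  assumes "C_pt y v 1 \<in> zero_locus wC S" "F \<in> S"
  shows "peval F (vector [y, v, 1]) = 0"
  using assms wpoint_self by (fastforce simp: zero_locus_def C_pt_def)

lemma zclosed_forms:
  assumes "zclosed K w Z"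
  obtains S where "\<And>F. F \<in> S \<Longrightarrow> \<exists>d. whomogeneous w d F" "Z = zero_locus w S"
  using assms unfolding zclosed_def by blast

lemma zclosure_C_aff:
  "zclosure wC {C_pt y v 1 | y v. (y, v) \<in> C_aff} =
     (C_bar :: ('k::{alg_closed_field, field_char_0} ^ 3) set set)"
proof (rule equalityI)
  have "zclosed UNIV wC (C_bar :: ('k ^ 3) set set)"
    unfolding zclosed_def C_bar_def
    by (intro exI[of _ "{C_poly}"]) (auto simp: defined_over_def intro: whomogeneous_C_poly)
  then show "zclosure wC {C_pt y v 1 | y v. (y, v) \<in> C_aff} \<subseteq> (C_bar :: ('k ^ 3) set set)"
    unfolding zclosure_def using C_pt_in_C_bar by (intro Inter_lower) auto
  show "(C_bar :: ('k ^ 3) set set) \<subseteq> zclosure wC {C_pt y v 1 | y v. (y, v) \<in> C_aff}"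
    unfolding zclosure_def
  proof (intro Inter_greatest)
    fix Z :: "('k ^ 3) set set"
    assume "Z \<in> {Z. zclosed UNIV wC Z \<and> {C_pt y v 1 | y v. (y, v) \<in> C_aff} \<subseteq> Z}"
    then have Z: "zclosed UNIV wC Z" "\<And>y v. (y, v) \<in> C_aff \<Longrightarrow> C_pt y v 1 \<in> Z" by blast+
    obtain S where S: "\<And>F. F \<in> S \<Longrightarrow> \<exists>d. whomogeneous wC d F" "Z = zero_locus wC S"
      using zclosed_forms[OF Z(1)] by blast
    show "C_bar \<subseteq> Z"
      using C_bar_subset_zero_locus[OF S(1)] C_pt_in_zero_locus[OF Z(2)[unfolded S(2)]]
      unfolding S(2) by blast
  qed
qed

text \<open>
  If neither closed set contains the curve, then each has a defining form that is nonzero somewhere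
  on the affine curve, although the product of the two forms is zero there.
\<close>

lemma zirreducible_C_bar: "zirreducible wC (C_bar :: ('k::{alg_closed_field, field_char_0} ^ 3) set set)"
  unfolding zirreducible_def
proof (intro conjI allI impI)
  show "(C_bar :: ('k ^ 3) set set) \<noteq> {}" using C_pt_infinity_in_C_bar by blast
  fix Z1 Z2 :: "('k ^ 3) set set"
  assume Z: "zclosed UNIV wC Z1 \<and> zclosed UNIV wC Z2 \<and> C_bar \<subseteq> Z1 \<union> Z2"
  obtain S1 where S1: "\<And>F. F \<in> S1 \<Longrightarrow> \<exists>d. whomogeneous wC d F" "Z1 = zero_locus wC S1"
    using zclosed_forms Z by blast
  obtain S2 where S2: "\<And>F. F \<in> S2 \<Longrightarrow> \<exists>d. whomogeneous wC d F" "Z2 = zero_locus wC S2"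
    using zclosed_forms Z by blast
  show "C_bar \<subseteq> Z1 \<or> C_bar \<subseteq> Z2"
  proof (rule ccontr)
    assume not: "\<not> (C_bar \<subseteq> Z1 \<or> C_bar \<subseteq> Z2)"
    obtain F y1 v1 where F: "F \<in> S1" "(y1, v1) \<in> C_aff" "peval F (vector [y1, v1, 1]) \<noteq> 0"
      using not S1 C_bar_subset_zero_locus[of S1] by blast
    obtain G y2 v2 where G: "G \<in> S2" "(y2, v2) \<in> C_aff" "peval G (vector [y2, v2, 1]) \<noteq> 0"
      using not S2 C_bar_subset_zero_locus[of S2] by blast
    have "peval F (vector [y, v, 1]) * peval G (vector [y, v, 1]) = 0" if yv: "(y, v) \<in> C_aff" for y v
    proof -
      have "C_pt y v 1 \<in> zero_locus wC S1 \<or> C_pt y v 1 \<in> zero_locus wC S2"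
        using C_pt_in_C_bar[OF yv] Z S1(2) S2(2) by blast
      then show ?thesis
        using C_pt_in_zero_locus[OF _ F(1)] C_pt_in_zero_locus[OF _ G(1)] by auto
    qed
    from quartic_chart_zero_product[OF this] F G show False by auto
  qed
qed

lemma smooth_at_wpointI:
  assumes "w $ j = 1" "x $ j = 1" "i \<noteq> j" "peval (partial_deriv i F) x \<noteq> 0"
  shows "smooth_at w F (wpoint w x)"
  unfolding smooth_at_def using assms wpoint_self by blast

lemma C_poly_partials:
  "peval (partial_deriv 1 C_poly) (vector [y, v, z]) = - (64 * y^3 + 272 * y * z\<^sup>2)"
  "peval (partial_deriv 2 C_poly) (vector [y, v, z]) = 2 * v"
  by (simp_all add: C_poly_def)

lemma E_poly_partials:
  "peval (partial_deriv 1 E_poly) (vector [X, Y, Z]) = - (3 * X\<^sup>2 - 34 * X * Z + 72 * Z\<^sup>2)"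
  "peval (partial_deriv 2 E_poly) (vector [X, Y, Z]) = 2 * Y * Z"
  "peval (partial_deriv 3 E_poly) (vector [X, Y, Z]) = Y\<^sup>2 + 17 * X\<^sup>2 - 144 * X * Z"
  by (simp_all add: E_poly_def algebra_simps power2_eq_square)

text \<open>
  On the chart \<open>z = 1\<close> a point with \<open>v = 0\<close> has a root of the quartic as coordinate, and this
  root is simple. At infinity \<open>v = 4\<close> or \<open>-4\<close> is nonzero.
\<close>

lemma smooth_at_C_bar:
  assumes "P \<in> (C_bar :: ('k::field_char_0 ^ 3) set set)"
  shows "smooth_at wC C_poly P"
  using assms
proof (cases rule: C_bar_cases)
  case (affine y v)
  show ?thesis
  proof (cases "v = 0")
    case False
    then show ?thesis unfolding affine(2) C_pt_def
      by (intro smooth_at_wpointI[of _ 3 _ 2]) (simp_all add: wC_nth C_poly_partials)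
  next
    case True
    then have "poly quartic y = 0" using affine(1) by (simp add: C_aff_def poly_quartic)
    then have "poly (pderiv quartic) y \<noteq> 0" by (rule quartic_simple_roots)
    moreover have "- (64 * y^3 + 272 * y * 1\<^sup>2) = - poly (pderiv quartic) y"
      by (simp add: poly_pderiv_quartic algebra_simps power2_eq_square power3_eq_cube)
    ultimately show ?thesis unfolding affine(2) C_pt_def
      by (intro smooth_at_wpointI[of _ 3 _ 1])
         (simp_all only: wC_nth C_poly_partials vector_3, simp_all)
  qed
next
  case plus
  show ?thesis unfolding plus C_pt_def
    by (intro smooth_at_wpointI[of _ 1 _ 2]) (simp_all add: wC_nth C_poly_partials)
next
  case minus
  show ?thesis unfolding minus C_pt_def
    by (intro smooth_at_wpointI[of _ 1 _ 2]) (simp_all add: wC_nth C_poly_partials)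
qed

lemma smooth_at_E_curve:
  assumes "P \<in> (E_curve :: ('k::field_char_0 ^ 3) set set)"
  shows "smooth_at wE E_poly P"
  using assms
proof (cases rule: E_curve_cases)
  case (affine X Y)
  show ?thesis
  proof (cases "Y = 0")
    case False
    then show ?thesis unfolding affine(2) E_pt_def
      by (intro smooth_at_wpointI[of _ 3 _ 2]) (simp_all add: wE_nth E_poly_partials)
  next
    case True
    then have "X = 0 \<or> X = 8 \<or> X = 9" using affine(1) by (auto simp: E_aff_def)
    then show ?thesis unfolding affine(2) E_pt_def
      by (intro smooth_at_wpointI[of _ 3 _ 1]) (auto simp: wE_nth E_poly_partials)
  qed
next
  case infinity
  show ?thesis unfolding infinity E_pt_def
    by (intro smooth_at_wpointI[of _ 2 _ 3]) (simp_all add: wE_nth E_poly_partials)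
qed

section \<open>The isomorphism\<close>

definition quad_plus :: "('k::field, 3) mpol" where
  "quad_plus = var 2 + 4 * (var 1)^2 + 17 * (var 3)^2"

definition quad_minus :: "('k::field, 3) mpol" where
  "quad_minus = 4 * (var 1)^2 + 17 * (var 3)^2 - var 2"

text \<open>
  The first tuple is the given formula for \<open>\<phi>\<close> with denominators cleared. It vanishes at
  \<open>(1 : -4 : 0)\<close>. The product of \<open>quad_plus\<close> and \<open>quad_minus\<close> is \<open>288 z\<^sup>4\<close> on the curve, so
  multiplication by \<open>quad_minus\<close> and division by \<open>2 z\<^sup>3\<close> give the second tuple.
\<close>

definition phi_atlas :: "(('k::field, 3) mpol ^ 3) set" where
  "phi_atlas =
    {vector [var 3 * quad_plus, 2 * var 1 * quad_plus, 2 * (var 3)^3],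
     vector [144 * (var 3)^2, 288 * var 1 * var 3, quad_minus]}"

text \<open>
  The first tuple is the formula \<open>(Y / (2 X), X - 72 / X)\<close> multiplied through by \<open>2 X\<close>, where
  \<open>X\<^sup>3 / Z\<close> is replaced by \<open>Y\<^sup>2 + 17 X\<^sup>2 - 72 X Z\<close>. It vanishes at \<open>(0 : 0 : 1)\<close>. The second tuple is
  the same formula multiplied through by \<open>2 Y\<close>, where \<open>Y\<^sup>2 / X\<close> is replaced by \<open>(X - 8) (X - 9)\<close>.
\<close>

definition psi_atlas :: "(('k::field, 3) mpol ^ 3) set" where
  "psi_atlas =
    {vector [var 2, 4 * ((var 2)^2 + 17 * (var 1)^2 - 144 * var 1 * var 3), 2 * var 1],
     vector [(var 1 - 8 * var 3) * (var 1 - 9 * var 3),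
       4 * ((var 1 - 8 * var 3) * (var 1 - 9 * var 3)) * ((var 1)^2 - 72 * (var 3)^2),
       2 * var 2 * var 3]}"

lemma whomogeneous_scaled_var_power:
  "n * w $ i = d \<Longrightarrow> whomogeneous w d (numeral k * (var i) ^ n :: ('k::field, 'n::finite) mpol)"
  by (rule whomogeneous_mult'[OF whomogeneous_numeral whomogeneous_power[OF whomogeneous_var]]) simp

lemma whomogeneous_quad:
  "whomogeneous wC 2 (quad_plus :: ('k::field, 3) mpol)"
  "whomogeneous wC 2 (quad_minus :: ('k::field, 3) mpol)"
proof -
  have "whomogeneous wC 2 (4 * (var 1)^2 :: ('k, 3) mpol)" "whomogeneous wC 2 (17 * (var 3)^2 :: ('k, 3) mpol)"
    by (rule whomogeneous_scaled_var_power, simp add: wC_nth)+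
  moreover have "whomogeneous wC 2 (var 2 :: ('k, 3) mpol)"
    using whomogeneous_var[of wC 2] by (simp add: wC_nth)
  ultimately show "whomogeneous wC 2 (quad_plus :: ('k, 3) mpol)" "whomogeneous wC 2 (quad_minus :: ('k, 3) mpol)"
    unfolding quad_plus_def quad_minus_def by (blast intro: whomogeneous_diff whomogeneous_add)+
qed

lemma phi_atlas_forms:
  fixes G :: "('k::field_char_0, 3) mpol ^ 3"
  assumes "G \<in> phi_atlas"
  shows "\<exists>e. \<forall>j. defined_over \<rat> (G $ j) \<and> whomogeneous wC (e * wE $ j) (G $ j)"
proof -
  have "defined_over \<rat> (quad_plus :: ('k, 3) mpol)" "defined_over \<rat> (quad_minus :: ('k, 3) mpol)"
    unfolding quad_plus_def quad_minus_def by (intro defined_over_intros subring_set_Rats)+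
  note def = this defined_over_intros subring_set_Rats
  note var = whomogeneous_var[of wC 1] whomogeneous_var[of wC 3]
  note deg = whomogeneous_mult'[OF var(2) whomogeneous_quad(1)]
    whomogeneous_mult'[OF whomogeneous_mult[OF whomogeneous_numeral var(1)] whomogeneous_quad(1)]
    whomogeneous_mult'[OF whomogeneous_mult[OF whomogeneous_numeral var(1)] var(2)]
    whomogeneous_scaled_var_power
  consider
    (plus) "G = vector [var 3 * quad_plus, 2 * var 1 * quad_plus, 2 * (var 3)^3]"
  | (minus) "G = vector [144 * (var 3)^2, 288 * var 1 * var 3, quad_minus]"
    using assms by (auto simp: phi_atlas_def)
  then show ?thesis
  proof cases
    case plus
    have "whomogeneous wC 3 (var 3 * quad_plus :: ('k, 3) mpol)"
        "whomogeneous wC 3 (2 * var 1 * quad_plus :: ('k, 3) mpol)"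
        "whomogeneous wC 3 (2 * (var 3)^3 :: ('k, 3) mpol)"
      by (rule deg, simp add: wC_nth)+
    moreover have "defined_over \<rat> (var 3 * quad_plus :: ('k, 3) mpol)"
        "defined_over \<rat> (2 * var 1 * quad_plus :: ('k, 3) mpol)"
        "defined_over \<rat> (2 * (var 3)^3 :: ('k, 3) mpol)"
      by (intro def)+
    ultimately show ?thesis
      unfolding plus by (intro exI[of _ 3]) (simp add: forall_3 wE_nth)
  next
    case minus
    have "whomogeneous wC 2 (144 * (var 3)^2 :: ('k, 3) mpol)"
        "whomogeneous wC 2 (288 * var 1 * var 3 :: ('k, 3) mpol)"
      by (rule deg, simp add: wC_nth)+
    moreover note whomogeneous_quad(2)
    moreover have "defined_over \<rat> (144 * (var 3)^2 :: ('k, 3) mpol)"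
        "defined_over \<rat> (288 * var 1 * var 3 :: ('k, 3) mpol)"
        "defined_over \<rat> (quad_minus :: ('k, 3) mpol)"
      by (intro def)+
    ultimately show ?thesis
      unfolding minus by (intro exI[of _ 2]) (simp add: forall_3 wE_nth)
  qed
qed

lemma psi_atlas_forms:
  fixes G :: "('k::field_char_0, 3) mpol ^ 3"
  assumes "G \<in> psi_atlas"
  shows "\<exists>e. \<forall>j. defined_over \<rat> (G $ j) \<and> whomogeneous wE (e * wC $ j) (G $ j)"
proof -
  note def = defined_over_intros subring_set_Rats
  note lin = whomogeneous_wE_linear
  have var: "whomogeneous wE 1 (var i :: ('k, 3) mpol)" for i
    using whomogeneous_var[of wE i] by (simp add: wE_nth)
  have sq: "whomogeneous wE 2 ((var i)^2 :: ('k, 3) mpol)" for i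
    using whomogeneous_power[OF var[of i], of 2] by simp
  have nsq: "whomogeneous wE 2 (numeral k * (var i)^2 :: ('k, 3) mpol)" for k i
    by (rule whomogeneous_mult'[OF whomogeneous_numeral sq]) simp
  have nvar: "whomogeneous wE 1 (numeral k * var i :: ('k, 3) mpol)" for k i
    by (rule whomogeneous_mult'[OF whomogeneous_numeral var]) simp
  have nvar2: "whomogeneous wE 2 (numeral k * var i * var j :: ('k, 3) mpol)" for k i j
    by (rule whomogeneous_mult'[OF nvar var]) simp
  have lin2: "whomogeneous wE 2 ((var 1 - 8 * var 3) * (var 1 - 9 * var 3) :: ('k, 3) mpol)"
    by (rule whomogeneous_mult'[OF lin lin]) simp
  consider
    (plus) "G = vector [var 2, 4 * ((var 2)^2 + 17 * (var 1)^2 - 144 * var 1 * var 3), 2 * var 1]"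
  | (minus) "G = vector [(var 1 - 8 * var 3) * (var 1 - 9 * var 3),
       4 * ((var 1 - 8 * var 3) * (var 1 - 9 * var 3)) * ((var 1)^2 - 72 * (var 3)^2),
       2 * var 2 * var 3]"
    using assms by (auto simp: psi_atlas_def)
  then show ?thesis
  proof cases
    case plus
    have "whomogeneous wE 2 (4 * ((var 2)^2 + 17 * (var 1)^2 - 144 * var 1 * var 3) :: ('k, 3) mpol)"
      by (rule whomogeneous_mult'[OF whomogeneous_numeral
            whomogeneous_diff[OF whomogeneous_add[OF sq nsq] nvar2]]) simp
    moreover have "defined_over \<rat> (var 2 :: ('k, 3) mpol)"
        "defined_over \<rat> (4 * ((var 2)^2 + 17 * (var 1)^2 - 144 * var 1 * var 3) :: ('k, 3) mpol)"
        "defined_over \<rat> (2 * var 1 :: ('k, 3) mpol)"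
      by (intro def)+
    ultimately show ?thesis
      unfolding plus using var nvar by (intro exI[of _ 1]) (simp add: forall_3 wC_nth)
  next
    case minus
    have "whomogeneous wE 4 (4 * ((var 1 - 8 * var 3) * (var 1 - 9 * var 3)) *
        ((var 1)^2 - 72 * (var 3)^2) :: ('k, 3) mpol)"
      by (rule whomogeneous_mult'[OF whomogeneous_mult[OF whomogeneous_numeral lin2]
            whomogeneous_diff[OF sq nsq]]) simp
    moreover have "defined_over \<rat> ((var 1 - 8 * var 3) * (var 1 - 9 * var 3) :: ('k, 3) mpol)"
        "defined_over \<rat> (4 * ((var 1 - 8 * var 3) * (var 1 - 9 * var 3)) *
           ((var 1)^2 - 72 * (var 3)^2) :: ('k, 3) mpol)"
        "defined_over \<rat> (2 * var 2 * var 3 :: ('k, 3) mpol)"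
      by (intro def)+
    ultimately show ?thesis
      unfolding minus using lin2 nvar2 by (intro exI[of _ 2]) (simp add: forall_3 wC_nth)
  qed
qed

lemma form_atlas_two:
  assumes forms: "\<And>G. G \<in> {G1, G2} \<Longrightarrow>
      \<exists>e. \<forall>j. defined_over K (G $ j) \<and> whomogeneous w (e * w' $ j) (G $ j)"
    and cover: "\<And>x. x \<noteq> 0 \<Longrightarrow> wpoint w x \<in> V \<Longrightarrow> pmap G1 x = 0 \<Longrightarrow> pmap G2 x \<noteq> 0"
    and target1: "\<And>x. x \<noteq> 0 \<Longrightarrow> wpoint w x \<in> V \<Longrightarrow> pmap G1 x \<noteq> 0 \<Longrightarrow> wpoint w' (pmap G1 x) \<in> V'"
    and target2: "\<And>x. x \<noteq> 0 \<Longrightarrow> wpoint w x \<in> V \<Longrightarrow> pmap G2 x \<noteq> 0 \<Longrightarrow> wpoint w' (pmap G2 x) \<in> V'"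
    and compat: "\<And>x. x \<noteq> 0 \<Longrightarrow> wpoint w x \<in> V \<Longrightarrow> pmap G1 x \<noteq> 0 \<Longrightarrow> pmap G2 x \<noteq> 0 \<Longrightarrow>
      wpoint w' (pmap G1 x) = wpoint w' (pmap G2 x)"
  shows "form_atlas K w V w' V' {G1, G2}"
  unfolding form_atlas_def
proof (intro conjI ballI allI impI)
  fix x assume x: "x \<noteq> 0 \<and> wpoint w x \<in> V"
  show "\<exists>G\<in>{G1, G2}. pmap G x \<noteq> 0" using cover x by blast
  fix G assume G: "G \<in> {G1, G2}" "pmap G x \<noteq> 0"
  show "wpoint w' (pmap G x) \<in> V'" using target1 target2 x G by auto
  fix H assume H: "H \<in> {G1, G2}" "pmap H x \<noteq> 0"
  show "wpoint w' (pmap G x) = wpoint w' (pmap H x)" using compat x G H by auto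
qed (rule forms)

lemma form_atlas_phi:
  "form_atlas \<rat> wC (C_bar :: ('k::field_char_0 ^ 3) set set) wE E_curve phi_atlas"
  unfolding phi_atlas_def
proof (rule form_atlas_two)
  fix G :: "('k, 3) mpol ^ 3"
  assume "G \<in> {vector [var 3 * quad_plus, 2 * var 1 * quad_plus, 2 * (var 3)^3],
     vector [144 * (var 3)^2, 288 * var 1 * var 3, quad_minus]}"
  then show "\<exists>e. \<forall>j. defined_over \<rat> (G $ j) \<and> whomogeneous wC (e * wE $ j) (G $ j)"
    by (intro phi_atlas_forms) (simp add: phi_atlas_def)
next
  fix x :: "'k ^ 3" assume x: "x \<noteq> 0" "wpoint wC x \<in> C_bar"
  obtain y v z where yvz: "x = vector [y, v, z]" by (rule vec3_cases)
  define W where "W = v + 4 * y\<^sup>2 + 17 * z\<^sup>2"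
  define W' where "W' = 4 * y\<^sup>2 + 17 * z\<^sup>2 - v"
  have v: "v\<^sup>2 = 16 * y^4 + 136 * y\<^sup>2 * z\<^sup>2 + z^4"
    using x by (simp add: wpoint_in_C_bar yvz peval_C_poly)
  have "W * W' = (4 * y\<^sup>2 + 17 * z\<^sup>2)\<^sup>2 - v\<^sup>2"
    unfolding W_def W'_def by (simp add: algebra_simps power2_eq_square)
  then have WW': "W * W' = 288 * z^4"
    unfolding v by (simp add: algebra_simps power2_eq_square power4_eq_xxxx)
  have sum: "W + W' = 8 * y\<^sup>2 + 34 * z\<^sup>2" by (simp add: W_def W'_def)
  let ?G = "vector [var 3 * quad_plus, 2 * var 1 * quad_plus, 2 * (var 3)^3] :: ('k, 3) mpol ^ 3"
  let ?H = "vector [144 * (var 3)^2, 288 * var 1 * var 3, quad_minus] :: ('k, 3) mpol ^ 3"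
  have G: "pmap ?G x = vector [z * W, 2 * y * W, 2 * z^3]"
    by (simp add: pmap_vec3 yvz quad_plus_def W_def)
  have H: "pmap ?H x = vector [144 * z\<^sup>2, 288 * y * z, W']"
    by (simp add: pmap_vec3 yvz quad_minus_def W'_def)
  have nz: "W \<noteq> 0 \<or> W' \<noteq> 0"
  proof (rule ccontr)
    assume "\<not> (W \<noteq> 0 \<or> W' \<noteq> 0)"
    then have W0: "W = 0" "W' = 0" by simp_all
    with WW' have "z = 0" by simp
    with W0 sum have "y = 0" by simp
    with \<open>z = 0\<close> v have "v = 0" by simp
    with \<open>y = 0\<close> \<open>z = 0\<close> x(1) show False by (simp add: yvz vec3_eq_0_iff)
  qed
  show "pmap ?H x \<noteq> 0" if "pmap ?G x = 0"
  proof
    assume "pmap ?H x = 0"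
    with that have "z = 0" "W' = 0" "y * W = 0" by (simp_all add: G H vec3_eq_0_iff)
    with nz sum show False by auto
  qed
  show "wpoint wE (pmap ?G x) \<in> E_curve" if "pmap ?G x \<noteq> 0"
  proof -
    (* For either tuple the equation of E comes down to W W' = 288 z^4 and W + W' = 8 y^2 + 34 z^2. *)
    have "(2 * y * W)\<^sup>2 * (2 * z^3) - z * W * (z * W - 8 * (2 * z^3)) * (z * W - 9 * (2 * z^3)) =
        z^3 * W * (W * (8 * y\<^sup>2 + 34 * z\<^sup>2 - W) - 288 * z^4)"
      by (simp add: algebra_simps power2_eq_square power3_eq_cube power4_eq_xxxx)
    also have "8 * y\<^sup>2 + 34 * z\<^sup>2 - W = W'" using sum by (simp add: algebra_simps)
    finally show ?thesis
      unfolding wpoint_in_E_curve[OF that] unfolding G peval_E_poly by (simp add: WW')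
  qed
  show "wpoint wE (pmap ?H x) \<in> E_curve" if "pmap ?H x \<noteq> 0"
  proof -
    have "(288 * y * z)\<^sup>2 * W' - 144 * z\<^sup>2 * (144 * z\<^sup>2 - 8 * W') * (144 * z\<^sup>2 - 9 * W') =
        10368 * z\<^sup>2 * ((8 * y\<^sup>2 + 34 * z\<^sup>2 - W') * W' - 288 * z^4)"
      by (simp add: algebra_simps power2_eq_square power3_eq_cube power4_eq_xxxx)
    also have "8 * y\<^sup>2 + 34 * z\<^sup>2 - W' = W" using sum by (simp add: algebra_simps)
    finally show ?thesis
      unfolding wpoint_in_E_curve[OF that] unfolding H peval_E_poly by (simp add: WW')
  qed
  (* The factor 2 z^3 / W' inverts the passage from the first tuple to the second. *)
  show "wpoint wE (pmap ?G x) = wpoint wE (pmap ?H x)" if "pmap ?G x \<noteq> 0" "pmap ?H x \<noteq> 0"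
  proof (rule wpoint_eqI)
    have z: "z \<noteq> 0"
    proof
      assume z0: "z = 0"
      then have "W' \<noteq> 0" using that(2) by (auto simp: H vec3_eq_0_iff)
      then have "W = 0" using WW' z0 by simp
      then show False using that(1) z0 by (simp add: G vec3_eq_0_iff)
    qed
    then have "W \<noteq> 0" "W' \<noteq> 0" using WW' by auto
    then show "2 * z^3 / W' \<noteq> 0" using z by simp
    have "z * W = 2 * z^3 / W' * (144 * z\<^sup>2)"
      using \<open>W' \<noteq> 0\<close> arg_cong[OF WW', of "\<lambda>a. z * a"]
      by (simp add: field_simps power2_eq_square power3_eq_cube power4_eq_xxxx)
    moreover have "2 * y * W = 2 * z^3 / W' * (288 * y * z)"
      using \<open>W' \<noteq> 0\<close> arg_cong[OF WW', of "\<lambda>a. 2 * y * a"]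
      by (simp add: field_simps power2_eq_square power3_eq_cube power4_eq_xxxx)
    ultimately show "pmap ?G x = wscale wE (2 * z^3 / W') (pmap ?H x)"
      using \<open>W' \<noteq> 0\<close> unfolding G H wscale_wE by (simp add: vec3_eq_iff)
  qed
qed

lemma form_atlas_psi:
  "form_atlas \<rat> wE (E_curve :: ('k::field_char_0 ^ 3) set set) wC C_bar psi_atlas"
  unfolding psi_atlas_def
proof (rule form_atlas_two)
  let ?G = "vector [var 2, 4 * ((var 2)^2 + 17 * (var 1)^2 - 144 * var 1 * var 3), 2 * var 1]
    :: ('k, 3) mpol ^ 3"
  let ?H = "vector [(var 1 - 8 * var 3) * (var 1 - 9 * var 3),
       4 * ((var 1 - 8 * var 3) * (var 1 - 9 * var 3)) * ((var 1)^2 - 72 * (var 3)^2),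
       2 * var 2 * var 3] :: ('k, 3) mpol ^ 3"
  show "\<exists>e. \<forall>j. defined_over \<rat> (G $ j) \<and> whomogeneous wE (e * wC $ j) (G $ j)"
    if "G \<in> {?G, ?H}" for G
    using that by (intro psi_atlas_forms) (simp add: psi_atlas_def)
  fix x :: "'k ^ 3" assume x: "x \<noteq> 0" "wpoint wE x \<in> E_curve"
  obtain X Y Z where XYZ: "x = vector [X, Y, Z]" by (rule vec3_cases)
  define Q where "Q = (X - 8 * Z) * (X - 9 * Z)"
  have eq: "Y\<^sup>2 * Z = X * Q"
    using x by (simp add: wpoint_in_E_curve XYZ peval_E_poly Q_def algebra_simps)
  have G: "pmap ?G x = vector [Y, 4 * (Y\<^sup>2 + 17 * X\<^sup>2 - 144 * X * Z), 2 * X]"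
    by (simp add: pmap_vec3 XYZ)
  have H: "pmap ?H x = vector [Q, 4 * Q * (X\<^sup>2 - 72 * Z\<^sup>2), 2 * Y * Z]"
    by (simp add: pmap_vec3 XYZ Q_def)
  have G0: "pmap ?G x = 0 \<longleftrightarrow> X = 0 \<and> Y = 0"
    unfolding G vec3_eq_0_iff by auto
  have H0: "pmap ?H x = 0 \<longleftrightarrow> Q = 0 \<and> Y * Z = 0"
    unfolding H vec3_eq_0_iff by auto
  show "pmap ?H x \<noteq> 0" if "pmap ?G x = 0"
    using that x(1) unfolding G0 H0 by (auto simp: Q_def XYZ vec3_eq_0_iff)
  show "wpoint wC (pmap ?G x) \<in> C_bar" if "pmap ?G x \<noteq> 0"
  proof -
    (* The equation of C holds identically in X, Y, Z up to a multiple of the equation of E. *)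
    have "(4 * (Y\<^sup>2 + 17 * X\<^sup>2 - 144 * X * Z))\<^sup>2 -
        (16 * Y^4 + 136 * Y\<^sup>2 * (2 * X)\<^sup>2 + (2 * X)^4) =
        4608 * X * (X * Q - Y\<^sup>2 * Z)"
      unfolding Q_def by (simp add: algebra_simps power2_eq_square power3_eq_cube power4_eq_xxxx)
    then show ?thesis
      unfolding wpoint_in_C_bar[OF that] unfolding G peval_C_poly by (simp add: eq)
  qed
  show "wpoint wC (pmap ?H x) \<in> C_bar" if "pmap ?H x \<noteq> 0"
  proof -
    have "(4 * Q * (X\<^sup>2 - 72 * Z\<^sup>2))\<^sup>2 -
        (16 * Q^4 + 136 * Q\<^sup>2 * (2 * Y * Z)\<^sup>2 + (2 * Y * Z)^4) =
        16 * Q\<^sup>2 * ((X\<^sup>2 - 72 * Z\<^sup>2)\<^sup>2 - Q\<^sup>2 - 34 * Z * (Y\<^sup>2 * Z)) - 16 * (Y\<^sup>2 * Z)\<^sup>2 * Z\<^sup>2"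
      by (simp add: algebra_simps power2_eq_square power4_eq_xxxx)
    (* Eliminating Y by means of Y^2 Z = X Q leaves an identity in X and Z. *)
    also have "\<dots> = 16 * Q\<^sup>2 * ((X\<^sup>2 - 72 * Z\<^sup>2)\<^sup>2 - Q\<^sup>2 - 34 * Z * (X * Q) - (X * Z)\<^sup>2)"
      unfolding eq by (simp add: algebra_simps power2_eq_square)
    also have "(X\<^sup>2 - 72 * Z\<^sup>2)\<^sup>2 - Q\<^sup>2 - 34 * Z * (X * Q) - (X * Z)\<^sup>2 = 0"
      unfolding Q_def by (simp add: algebra_simps power2_eq_square)
    finally show ?thesis
      unfolding wpoint_in_C_bar[OF that] unfolding H peval_C_poly by simp
  qed
  (* The affine formulas were cleared of denominators by 2 X and by 2 Y, hence the factor Y Z / X. *)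
  show "wpoint wC (pmap ?G x) = wpoint wC (pmap ?H x)" if "pmap ?G x \<noteq> 0" "pmap ?H x \<noteq> 0"
  proof -
    have Z: "Z \<noteq> 0"
    proof
      assume "Z = 0"
      then have "Q = 0" using eq by (auto simp: Q_def)
      then show False using that(2) \<open>Z = 0\<close> unfolding H0 by simp
    qed
    have X: "X \<noteq> 0"
    proof
      assume "X = 0"
      then have "Y = 0" using eq Z by simp
      then show False using that(1) \<open>X = 0\<close> unfolding G0 by simp
    qed
    have Y: "Y \<noteq> 0"
    proof
      assume "Y = 0"
      then have "Q = 0" using eq X by simp
      then show False using that(2) \<open>Y = 0\<close> unfolding H0 by simp
    qed
    have Q: "Q = Y * Z / X * Y"
      using eq X by (simp add: field_simps power2_eq_square)
    have "Z * (Y\<^sup>2 + 17 * X\<^sup>2 - 144 * X * Z) = Y\<^sup>2 * Z + 17 * X\<^sup>2 * Z - 144 * X * Z\<^sup>2"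
      by (simp add: algebra_simps power2_eq_square)
    also have "\<dots> = X * (X\<^sup>2 - 72 * Z\<^sup>2)"
      unfolding eq Q_def by (simp add: algebra_simps power2_eq_square)
    finally have cubic: "X * (X\<^sup>2 - 72 * Z\<^sup>2) = Z * (Y\<^sup>2 + 17 * X\<^sup>2 - 144 * X * Z)" ..
    have "4 * Q * (X\<^sup>2 - 72 * Z\<^sup>2) = 4 * (Y * Y * Z / (X * X)) * (X * (X\<^sup>2 - 72 * Z\<^sup>2))"
      unfolding Q using X by simp
    also have "\<dots> = (Y * Z / X)\<^sup>2 * (4 * (Y\<^sup>2 + 17 * X\<^sup>2 - 144 * X * Z))"
      unfolding cubic by (simp add: power2_eq_square)
    finally have "pmap ?H x = wscale wC (Y * Z / X) (pmap ?G x)"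
      unfolding G H wscale_wC using X Q by (simp add: vec3_eq_iff)
    moreover have "Y * Z / X \<noteq> 0" using X Y Z by simp
    ultimately show ?thesis by (simp add: wpoint_wscale)
  qed
qed

text \<open>
  Everything follows from \<open>X (X - v) = 72\<close> and \<open>4 y\<^sup>2 = 2 X - v - 17\<close>, the latter being the
  definition of \<open>X\<close> and the former the equation of the curve in terms of \<open>X\<close> and \<open>v\<close>.
\<close>

lemma phi_on_C_aff:
  fixes y v :: "'k::field_char_0"
  assumes C: "(y, v) \<in> C_aff" and phi: "phi (y, v) = (X, Y)"
  shows "(X, Y) \<in> E_aff" "X \<noteq> 0" "Y / (2 * X) = y" "X - 72 / X = v"
proof -
  have X: "2 * X = v + 4 * y\<^sup>2 + 17" and Y: "Y = 2 * X * y"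
    using phi by (auto simp: phi_def)
  have y2: "4 * y\<^sup>2 = 2 * X - v - 17" using X by (simp add: algebra_simps)
  have "16 * y^4 + 136 * y\<^sup>2 + 1 = (4 * y\<^sup>2)\<^sup>2 + 34 * (4 * y\<^sup>2) + 1"
    by (simp add: power2_eq_square power4_eq_xxxx)
  also have "\<dots> = 4 * (X * (X - v)) - 288 + v\<^sup>2"
    unfolding y2 by (simp add: algebra_simps power2_eq_square)
  finally have "4 * (X * (X - v)) = 4 * 72" using C by (simp add: C_aff_def)
  then have conj: "X * (X - v) = 72" unfolding mult_cancel_left by simp
  then show X0: "X \<noteq> 0" by auto
  then show "Y / (2 * X) = y" by (simp add: Y)
  show "X - 72 / X = v" using X0 conj by (simp add: field_simps)
  have "Y\<^sup>2 = X * X * (4 * y\<^sup>2)" by (simp add: Y power2_eq_square)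
  also have "\<dots> = X * (X * X + X * (X - v) - 17 * X)"
    unfolding y2 by (simp add: algebra_simps)
  also have "\<dots> = X * (X - 8) * (X - 9)"
    unfolding conj by (simp add: algebra_simps)
  finally show "(X, Y) \<in> E_aff" by (simp add: E_aff_def)
qed

text \<open>
  The same two relations: the definition of \<open>v\<close> gives the first, and the equation of \<open>E\<close> divided
  by \<open>X\<^sup>2\<close> the second.
\<close>

lemma phi_inverse_on_E_aff:
  fixes X Y :: "'k::field_char_0"
  assumes E: "(X, Y) \<in> E_aff" and X0: "X \<noteq> 0"
  shows "(Y / (2 * X), X - 72 / X) \<in> C_aff" "phi (Y / (2 * X), X - 72 / X) = (X, Y)"
proof -
  define y where "y = Y / (2 * X)"
  define v where "v = X - 72 / X"
  have conj: "X * (X - v) = 72" using X0 by (simp add: v_def)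
  have "X * X * (4 * y\<^sup>2) = Y\<^sup>2" using X0 by (simp add: y_def power2_eq_square)
  also have "\<dots> = X * (X * X + 72 - 17 * X)"
    using E by (simp add: E_aff_def algebra_simps)
  also have "\<dots> = X * X * (2 * X - v - 17)"
    unfolding conj[symmetric] by (simp add: algebra_simps)
  finally have y2: "4 * y\<^sup>2 = 2 * X - v - 17" using X0 unfolding mult_cancel_left by simp
  have "16 * y^4 + 136 * y\<^sup>2 + 1 = (4 * y\<^sup>2)\<^sup>2 + 34 * (4 * y\<^sup>2) + 1"
    by (simp add: power2_eq_square power4_eq_xxxx)
  also have "\<dots> = 4 * (X * (X - v)) - 288 + v\<^sup>2"
    unfolding y2 by (simp add: algebra_simps power2_eq_square)
  also have "\<dots> = v\<^sup>2" by (simp add: conj)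
  finally show "(Y / (2 * X), X - 72 / X) \<in> C_aff"
    by (simp add: C_aff_def y_def v_def)
  have "v + 4 * y\<^sup>2 + 17 = 2 * X" unfolding y2 by simp
  moreover have "y * (2 * X) = Y" using X0 by (simp add: y_def)
  ultimately have "phi (y, v) = (X, Y)" by (simp add: phi_def)
  then show "phi (Y / (2 * X), X - 72 / X) = (X, Y)" by (simp add: y_def v_def)
qed

text \<open>
  Values of the two maps are computed by exhibiting one tuple of the atlas and the scalar that relates
  its value to the desired coordinates.
\<close>

lemma glue_phi:
  assumes "P \<in> (C_bar :: ('k::field_char_0 ^ 3) set set)" "P = wpoint wC x" "G \<in> phi_atlas"
    and "pmap G x = wscale wE c y" "c \<noteq> 0" "y \<noteq> 0"
  shows "glue wE phi_atlas P = wpoint wE y"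
proof -
  have "pmap G x \<noteq> 0" using assms(4-6) by (simp add: wscale_eq_0_iff)
  moreover have "x \<in> P" unfolding assms(2) by (rule wpoint_self)
  ultimately have "glue wE phi_atlas P = wpoint wE (pmap G x)"
    by (intro glue_eq[OF form_atlas_phi C_bar_subset assms(1) _ assms(3)])
  then show ?thesis using assms(4,5) by (simp add: wpoint_wscale)
qed

lemma glue_psi:
  assumes "Q \<in> (E_curve :: ('k::field_char_0 ^ 3) set set)" "Q = wpoint wE x" "G \<in> psi_atlas"
    and "pmap G x = wscale wC c y" "c \<noteq> 0" "y \<noteq> 0"
  shows "glue wC psi_atlas Q = wpoint wC y"
proof -
  have "pmap G x \<noteq> 0" using assms(4-6) by (simp add: wscale_eq_0_iff)
  moreover have "x \<in> Q" unfolding assms(2) by (rule wpoint_self)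
  ultimately have "glue wC psi_atlas Q = wpoint wC (pmap G x)"
    by (intro glue_eq[OF form_atlas_psi E_curve_subset assms(1) _ assms(3)])
  then show ?thesis using assms(4,5) by (simp add: wpoint_wscale)
qed

lemma E_pt_in_E_curve: "(X, Y) \<in> E_aff \<Longrightarrow> E_pt X Y 1 \<in> E_curve"
  by (simp add: E_pt_def wpoint_in_E_curve vec3_eq_0_iff peval_E_poly E_aff_def)

lemma E_pt_special_in_E_curve: "E_pt 0 1 0 \<in> E_curve" "E_pt 0 0 1 \<in> E_curve"
  by (simp_all add: E_pt_def wpoint_in_E_curve vec3_eq_0_iff peval_E_poly)

lemma glue_phi_affine:
  fixes y v :: "'k::field_char_0"
  assumes "(y, v) \<in> C_aff" "phi (y, v) = (X, Y)"
  shows "glue wE phi_atlas (C_pt y v 1) = E_pt X Y 1"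
  unfolding E_pt_def
proof (rule glue_phi[OF C_pt_in_C_bar[OF assms(1)] C_pt_def])
  show "vector [var 3 * quad_plus, 2 * var 1 * quad_plus, 2 * (var 3)^3] \<in> phi_atlas"
    by (simp add: phi_atlas_def)
  have "v + 4 * y\<^sup>2 + 17 = 2 * X" "Y = y * (v + 4 * y\<^sup>2 + 17)"
    using assms(2) by (auto simp: phi_def)
  then show "pmap (vector [var 3 * quad_plus, 2 * var 1 * quad_plus, 2 * (var 3)^3])
      (vector [y, v, 1]) = wscale wE 2 (vector [X, Y, 1])"
    by (simp add: pmap_vec3 wscale_wE vec3_eq_iff quad_plus_def)
qed (simp_all add: vec3_eq_0_iff)

lemma glue_phi_infinity:
  "glue wE phi_atlas (C_pt 1 4 0 :: ('k::field_char_0 ^ 3) set) = E_pt 0 1 0"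
  "glue wE phi_atlas (C_pt 1 (- 4) 0 :: ('k ^ 3) set) = E_pt 0 0 1"
  unfolding E_pt_def
proof -
  show "glue wE phi_atlas (C_pt 1 4 0 :: ('k ^ 3) set) = wpoint wE (vector [0, 1, 0])"
    by (rule glue_phi[OF C_pt_infinity_in_C_bar(1) C_pt_def, where c = 16
          and G = "vector [var 3 * quad_plus, 2 * var 1 * quad_plus, 2 * (var 3)^3]"])
       (simp_all add: phi_atlas_def pmap_vec3 wscale_wE vec3_eq_iff vec3_eq_0_iff quad_plus_def)
  show "glue wE phi_atlas (C_pt 1 (- 4) 0 :: ('k ^ 3) set) = wpoint wE (vector [0, 0, 1])"
    by (rule glue_phi[OF C_pt_infinity_in_C_bar(2) C_pt_def, where c = 8
          and G = "vector [144 * (var 3)^2, 288 * var 1 * var 3, quad_minus]"])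
       (simp_all add: phi_atlas_def pmap_vec3 wscale_wE vec3_eq_iff vec3_eq_0_iff quad_minus_def)
qed

lemma glue_psi_affine:
  fixes X Y :: "'k::field_char_0"
  assumes "(X, Y) \<in> E_aff" "X \<noteq> 0"
  shows "glue wC psi_atlas (E_pt X Y 1) = C_pt (Y / (2 * X)) (X - 72 / X) 1"
  unfolding C_pt_def
proof (rule glue_psi[OF E_pt_in_E_curve[OF assms(1)] E_pt_def])
  let ?G = "vector [var 2, 4 * ((var 2)^2 + 17 * (var 1)^2 - 144 * var 1 * var 3), 2 * var 1]
    :: ('k, 3) mpol ^ 3"
  show "?G \<in> psi_atlas" by (simp add: psi_atlas_def)
  have Y: "Y\<^sup>2 = X * (X - 8) * (X - 9)" using assms(1) by (simp add: E_aff_def)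
  have "4 * (Y\<^sup>2 + 17 * X\<^sup>2 - 144 * X) = (2 * X)\<^sup>2 * (X - 72 / X)"
    unfolding Y using assms(2) by (simp add: field_simps power2_eq_square)
  then show "pmap ?G (vector [X, Y, 1]) = wscale wC (2 * X) (vector [Y / (2 * X), X - 72 / X, 1])"
    using assms(2) unfolding pmap_vec3 wscale_wC vec3_eq_iff by simp
qed (use assms(2) in \<open>simp_all add: vec3_eq_0_iff\<close>)

lemma glue_psi_special:
  "glue wC psi_atlas (E_pt 0 1 0 :: ('k::field_char_0 ^ 3) set) = C_pt 1 4 0"
  "glue wC psi_atlas (E_pt 0 0 1 :: ('k ^ 3) set) = C_pt 1 (- 4) 0"
  unfolding C_pt_def
proof -
  show "glue wC psi_atlas (E_pt 0 1 0 :: ('k ^ 3) set) = wpoint wC (vector [1, 4, 0])"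
    by (rule glue_psi[OF E_pt_special_in_E_curve(1) E_pt_def, where c = 1
          and G = "vector [var 2, 4 * ((var 2)^2 + 17 * (var 1)^2 - 144 * var 1 * var 3), 2 * var 1]"])
       (simp add: psi_atlas_def, simp_all add: pmap_vec3 vec3_eq_iff vec3_eq_0_iff)
  show "glue wC psi_atlas (E_pt 0 0 1 :: ('k ^ 3) set) = wpoint wC (vector [1, - 4, 0])"
    by (rule glue_psi[OF E_pt_special_in_E_curve(2) E_pt_def, where c = 72
          and G = "vector [(var 1 - 8 * var 3) * (var 1 - 9 * var 3),
            4 * ((var 1 - 8 * var 3) * (var 1 - 9 * var 3)) * ((var 1)^2 - 72 * (var 3)^2),
            2 * var 2 * var 3]"])
       (simp add: psi_atlas_def, simp_all add: pmap_vec3 wscale_wC vec3_eq_iff vec3_eq_0_iff)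
qed

lemma glue_psi_phi:
  assumes "P \<in> (C_bar :: ('k::field_char_0 ^ 3) set set)"
  shows "glue wC psi_atlas (glue wE phi_atlas P) = P"
  using assms
proof (cases rule: C_bar_cases)
  case (affine y v)
  obtain X Y where XY: "phi (y, v) = (X, Y)" by (cases "phi (y, v)")
  note E = phi_on_C_aff[OF affine(1) XY]
  show ?thesis
    unfolding affine(2) glue_phi_affine[OF affine(1) XY] glue_psi_affine[OF E(1,2)] E(3,4) ..
qed (simp_all add: glue_phi_infinity glue_psi_special)

lemma glue_phi_psi:
  assumes "Q \<in> (E_curve :: ('k::field_char_0 ^ 3) set set)"
  shows "glue wE phi_atlas (glue wC psi_atlas Q) = Q"
  using assms
proof (cases rule: E_curve_cases)
  case (affine X Y)
  show ?thesis
  proof (cases "X = 0")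
    case False
    note C = phi_inverse_on_E_aff[OF affine(1) False]
    show ?thesis
      unfolding affine(2) glue_psi_affine[OF affine(1) False] by (rule glue_phi_affine[OF C])
  next
    case True
    then have "Y = 0" using affine(1) by (simp add: E_aff_def)
    then show ?thesis by (simp add: affine(2) True glue_phi_infinity glue_psi_special)
  qed
qed (simp add: glue_phi_infinity glue_psi_special)

lemma isomorphism_phi:
  "isomorphism_over \<rat> wC (C_bar :: ('k::field_char_0 ^ 3) set set) wE E_curve
     (glue wE phi_atlas) (glue wC psi_atlas)"
  unfolding isomorphism_over_def
  using morphism_over_glue[OF form_atlas_phi C_bar_subset E_curve_subset wE_pos subring_set_Rats]
    morphism_over_glue[OF form_atlas_psi E_curve_subset C_bar_subset wC_pos subring_set_Rats]
  by (simp add: glue_psi_phi glue_phi_psi)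

lemma zirreducible_E_curve:
  "zirreducible wE (E_curve :: ('k::{alg_closed_field, field_char_0} ^ 3) set set)"
proof (rule zirreducible_image[OF zirreducible_C_bar])
  show "morphism_over UNIV wC (C_bar :: ('k ^ 3) set set) wE E_curve (glue wE phi_atlas)"
    by (rule morphism_over_glue[OF form_atlas_UNIV[OF form_atlas_phi] C_bar_subset E_curve_subset
          wE_pos subring_set_UNIV])
  show "glue wE phi_atlas ` C_bar = (E_curve :: ('k ^ 3) set set)"
  proof (intro equalityI subsetI)
    fix Q :: "('k ^ 3) set" assume "Q \<in> E_curve"
    then have "glue wC psi_atlas Q \<in> C_bar" "glue wE phi_atlas (glue wC psi_atlas Q) = Q"
      by (simp_all add: glue_in[OF form_atlas_psi E_curve_subset] glue_phi_psi)
    then show "Q \<in> glue wE phi_atlas ` C_bar" by (intro image_eqI[OF sym])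
  next
    fix Q :: "('k ^ 3) set" assume "Q \<in> glue wE phi_atlas ` C_bar"
    then show "Q \<in> E_curve" by (elim imageE) (simp only: glue_in[OF form_atlas_phi C_bar_subset])
  qed
qed

lemma smooth_projective_C_bar:
  "smooth_projective_curve \<rat> wC (C_poly :: ('k::{alg_closed_field, field_char_0}, 3) mpol)"
  unfolding smooth_projective_curve_def C_bar_def[symmetric]
proof (intro conjI ballI exI)
  show "defined_over \<rat> (C_poly :: ('k, 3) mpol)"
    unfolding C_poly_def by (intro defined_over_intros subring_set_Rats)
qed (rule whomogeneous_C_poly zirreducible_C_bar smooth_at_C_bar, assumption?)+

lemma smooth_projective_E_curve:
  "smooth_projective_curve \<rat> wE (E_poly :: ('k::{alg_closed_field, field_char_0}, 3) mpol)"
  unfolding smooth_projective_curve_def E_curve_def[symmetric]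
proof (intro conjI ballI exI)
  show "defined_over \<rat> (E_poly :: ('k, 3) mpol)"
    unfolding E_poly_def by (intro defined_over_intros subring_set_Rats)
qed (rule whomogeneous_E_poly zirreducible_E_curve smooth_at_E_curve, assumption?)+

theorem proposition2:
  shows "(\<forall>(y, v) \<in> (C_aff :: ('k::{alg_closed_field, field_char_0} \<times> 'k) set). phi (y, v) \<in> E_aff) \<and>
    zclosure wC {C_pt y v 1 | y v. (y, v) \<in> (C_aff :: ('k \<times> 'k) set)} = C_bar \<and>
    smooth_projective_curve \<rat> wC (C_poly :: ('k, 3) mpol) \<and>
    smooth_projective_curve \<rat> wE (E_poly :: ('k, 3) mpol) \<and>
    (\<exists>\<Phi> \<Psi>. isomorphism_over \<rat> wC (C_bar :: ('k ^ 3) set set) wE E_curve \<Phi> \<Psi> \<and>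
       (\<forall>(y, v) \<in> C_aff. case phi (y, v) of (X, Y) \<Rightarrow> \<Phi> (C_pt y v 1) = E_pt X Y 1) \<and>
       \<Phi> (C_pt 1 4 0) = E_pt 0 1 0 \<and>
       \<Phi> (C_pt 1 (-4) 0) = E_pt 0 0 1 \<and>
       (\<forall>(X, Y) \<in> E_aff. X \<noteq> 0 \<longrightarrow> \<Psi> (E_pt X Y 1) = C_pt (Y / (2 * X)) (X - 72 / X) 1))"
proof (intro conjI, goal_cases)
  case 1
  show ?case
  proof clarify
    fix y v :: 'k assume "(y, v) \<in> C_aff"
    then show "phi (y, v) \<in> E_aff"
      by (cases "phi (y, v)") (simp add: phi_on_C_aff(1))
  qed
next
  case 5
  show ?case
  proof (rule exI[of _ "glue wE phi_atlas"], rule exI[of _ "glue wC psi_atlas"], intro conjI)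
    show "\<forall>(y, v) \<in> (C_aff :: ('k \<times> 'k) set).
        case phi (y, v) of (X, Y) \<Rightarrow> glue wE phi_atlas (C_pt y v 1) = E_pt X Y 1"
      by (clarsimp split: prod.splits) (rule glue_phi_affine)
    show "\<forall>(X, Y) \<in> (E_aff :: ('k \<times> 'k) set).
        X \<noteq> 0 \<longrightarrow> glue wC psi_atlas (E_pt X Y 1) = C_pt (Y / (2 * X)) (X - 72 / X) 1"
      using glue_psi_affine by auto
  qed (fact isomorphism_phi glue_phi_infinity)+
qed (fact zclosure_C_aff smooth_projective_C_bar smooth_projective_E_curve)+

end
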